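(* Let $\varphi$ and $\psi$ be analytic self-maps of $\mathbb{D}$. Let $F(\varphi)$ be the set of points $\zeta\in\partial\mathbb{D}$ with $|\varphi(\zeta)|=1$, and define $F(\psi)$ similarly. Suppose that $F(\varphi)=F(\psi)=:F$. (a) Suppose $C_\varphi$ and $C_\psi$ are bounded on $S^2=\mathcal{D}_{-1}$. If $\varphi$ and $\psi$ have second order data at each point $\zeta\in F$ and $C_\varphi-C_\psi$ is compact on $S^2$, then $\varphi$ and $\psi$ have the same second order data at each point $\zeta\in F$. (b) Let $\gamma>-1$ and suppose $C_\varphi$ and $C_\psi$ are bounded on $\mathcal{D}_\alpha$ for some $\alpha$ with $-1\leq\alpha<\gamma$. If $\varphi$ and $\psi$ have finite angular derivative and second order data at each point $\zeta\in F$ and $C_\varphi-C_\psi$ is compact on $\mathcal{D}_\gamma$, then $\varphi$ and $\psi$ have the same second order data at each point $\zeta\in F$.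
   Context: $\mathbb{D}=\{z\in\mathbb{C}:|z|<1\}$. For an analytic self-map $\varphi$ of $\mathbb{D}$, the composition operator is $C_\varphi f=f\circ\varphi$. For $\alpha\ge-1$, the weighted Dirichlet space $\mathcal{D}_\alpha$ is the Hilbert space of analytic functions $f(z)=\sum_{n\ge0}a_nz^n$ on $\mathbb{D}$ with $\|f\|_{\mathcal{D}_\alpha}^2=|a_0|^2+\sum_{n=1}^\infty n^{1-\alpha}|a_n|^2<\infty$; $S^2=\mathcal{D}_{-1}$ is the space of analytic $f$ on $\mathbb{D}$ with $f'\in H^2$ (the Hardy space). For $\zeta\in\partial\mathbb{D}$, $\varphi(\zeta)$ denotes the radial limit of $\varphi$ at $\zeta$. Nontangential limits: for $\zeta\in\partial\mathbb{D}$ and $M>1$ let $\Gamma(\zeta,M)=\{z\in\mathbb{D}:|z-\zeta|<M(1-|z|)\}$; $\angle\lim_{z\to\zeta}f(z)$ denotes the common limit of $f(z)$ as $z\to\zeta$ within each $\Gamma(\zeta,M)$. An analytic self-map $\varphi$ of $\mathbb{D}$ has finite angular derivative at $\zeta\in\partial\mathbb{D}$ if there is $\eta\in\partial\mathbb{D}$ such that $\varphi'(\zeta):=\angle\lim_{z\to\zeta}\frac{\eta-\varphi(z)}{\zeta-z}$ exists as a finite complex number. It is a known fact that if $C_\varphi$ is bounded on $S^2$, then $\varphi$ has finite angular derivative at every $\zeta\in\partial\mathbb{D}$ with $|\varphi(\zeta)|=1$. $\varphi$ has second order data at $\zeta\in\partial\mathbb{D}$ if it is twice differentiable at $\zeta$,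 meaning that $\varphi$, considered as a function on $\mathbb{D}\cup\{\zeta\}$, is twice continuously differentiable. If $\varphi,\psi$ both have finite angular derivative at $\zeta$, they have the same first order data at $\zeta$ if $\varphi(\zeta)=\psi(\zeta)$ (as radial limits) and $\varphi'(\zeta)=\psi'(\zeta)$. If in addition $\varphi$ and $\psi$ are twice differentiable at $\zeta$ (meaning that $\varphi$ and $\psi$, considered as functions on $\mathbb{D}\cup\{\zeta\}$, are twice continuously differentiable) and $\varphi''(\zeta)=\psi''(\zeta)$, they have the same second order data at $\zeta$. *)

theory Defs
  imports "HOL-Complex_Analysis.Complex_Analysis"
begin

abbreviation unit_disc :: "complex set" ("\<D>") where
  "\<D> \<equiv> ball 0 1"

abbreviation unit_circle :: "complex set" ("\<T>") where
  "\<T> \<equiv> sphere 0 1"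

definition analytic_self_map :: "(complex \<Rightarrow> complex) \<Rightarrow> bool" where
  "analytic_self_map \<phi> \<longleftrightarrow> \<phi> holomorphic_on \<D> \<and> \<phi> ` \<D> \<subseteq> \<D>"

subsection \<open>Weighted Dirichlet spaces\<close>

text \<open>
  Functions on the disc are represented by total functions on the complex plane. Membership and
  norm below only depend on the values in the disc, so two total functions that agree there
  represent the same element.
\<close>

definition taylor_coeff :: "(complex \<Rightarrow> complex) \<Rightarrow> nat \<Rightarrow> complex" where
  "taylor_coeff f n = (deriv ^^ n) f 0 / fact n"

definition dirichlet_space :: "real \<Rightarrow> (complex \<Rightarrow> complex) set" where
  "dirichlet_space \<alpha> = {f. f holomorphic_on \<D> \<and>
     summable (\<lambda>n. real (Suc n) powr (1 - \<alpha>) * (cmod (taylor_coeff f (Suc n)))\<^sup>2)}"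

definition dirichlet_norm :: "real \<Rightarrow> (complex \<Rightarrow> complex) \<Rightarrow> real" where
  "dirichlet_norm \<alpha> f = sqrt ((cmod (taylor_coeff f 0))\<^sup>2 +
     (\<Sum>n. real (Suc n) powr (1 - \<alpha>) * (cmod (taylor_coeff f (Suc n)))\<^sup>2))"

definition comp_op :: "(complex \<Rightarrow> complex) \<Rightarrow> (complex \<Rightarrow> complex) \<Rightarrow> complex \<Rightarrow> complex" where
  "comp_op \<phi> f = f \<circ> \<phi>"

definition comp_op_diff ::
  "(complex \<Rightarrow> complex) \<Rightarrow> (complex \<Rightarrow> complex) \<Rightarrow> (complex \<Rightarrow> complex) \<Rightarrow> complex \<Rightarrow> complex" where
  "comp_op_diff \<phi> \<psi> f = (\<lambda>z. comp_op \<phi> f z - comp_op \<psi> f z)"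

definition bounded_operator_on :: "real \<Rightarrow> ((complex \<Rightarrow> complex) \<Rightarrow> complex \<Rightarrow> complex) \<Rightarrow> bool" where
  "bounded_operator_on \<alpha> T \<longleftrightarrow>
     (\<forall>f\<in>dirichlet_space \<alpha>. T f \<in> dirichlet_space \<alpha>) \<and>
     (\<exists>C. \<forall>f\<in>dirichlet_space \<alpha>. dirichlet_norm \<alpha> (T f) \<le> C * dirichlet_norm \<alpha> f)"

text \<open>
  Compactness: the image of every bounded sequence has a norm-convergent subsequence. Linearity is
  not part of this definition or the previous one; it is automatic for composition operators and
  their differences.
\<close>

definition compact_operator_on :: "real \<Rightarrow> ((complex \<Rightarrow> complex) \<Rightarrow> complex \<Rightarrow> complex) \<Rightarrow> bool" where
  "compact_operator_on \<alpha> T \<longleftrightarrow>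
     (\<forall>f\<in>dirichlet_space \<alpha>. T f \<in> dirichlet_space \<alpha>) \<and>
     (\<forall>s :: nat \<Rightarrow> complex \<Rightarrow> complex.
        (\<forall>n. s n \<in> dirichlet_space \<alpha>) \<and> (\<exists>B. \<forall>n. dirichlet_norm \<alpha> (s n) \<le> B) \<longrightarrow>
        (\<exists>r g. strict_mono r \<and> g \<in> dirichlet_space \<alpha> \<and>
           (\<lambda>n. dirichlet_norm \<alpha> (\<lambda>z. T (s (r n)) z - g z)) \<longlonglongrightarrow> 0))"

subsection \<open>Boundary behaviour\<close>

definition has_radial_limit :: "(complex \<Rightarrow> complex) \<Rightarrow> complex \<Rightarrow> complex \<Rightarrow> bool" where
  "has_radial_limit f \<zeta> w \<longleftrightarrow> ((\<lambda>r. f (complex_of_real r * \<zeta>)) \<longlongrightarrow> w) (at_left 1)"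

definition radial_limit :: "(complex \<Rightarrow> complex) \<Rightarrow> complex \<Rightarrow> complex" where
  "radial_limit f \<zeta> = (THE w. has_radial_limit f \<zeta> w)"

definition unimodular_set :: "(complex \<Rightarrow> complex) \<Rightarrow> complex set" where
  "unimodular_set \<phi> = {\<zeta>\<in>\<T>. \<exists>w. has_radial_limit \<phi> \<zeta> w \<and> cmod w = 1}"

definition nontangential_region :: "complex \<Rightarrow> real \<Rightarrow> complex set" where
  "nontangential_region \<zeta> M = {z\<in>\<D>. cmod (z - \<zeta>) < M * (1 - cmod z)}"

definition has_nontangential_limit :: "(complex \<Rightarrow> complex) \<Rightarrow> complex \<Rightarrow> complex \<Rightarrow> bool" where
  "has_nontangential_limit f \<zeta> l \<longleftrightarrow>
     (\<forall>M>1. (f \<longlongrightarrow> l) (at \<zeta> within nontangential_region \<zeta> M))"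

text \<open>
  The point \<open>\<eta>\<close> and the value \<open>d\<close> are unique when they exist: a finite limit of the difference
  quotient forces \<open>\<phi>\<close> to tend to \<open>\<eta>\<close> nontangentially.
\<close>

definition has_angular_derivative :: "(complex \<Rightarrow> complex) \<Rightarrow> complex \<Rightarrow> complex \<Rightarrow> bool" where
  "has_angular_derivative \<phi> \<zeta> d \<longleftrightarrow>
     (\<exists>\<eta>\<in>\<T>. has_nontangential_limit (\<lambda>z. (\<eta> - \<phi> z) / (\<zeta> - z)) \<zeta> d)"

definition finite_angular_derivative :: "(complex \<Rightarrow> complex) \<Rightarrow> complex \<Rightarrow> bool" where
  "finite_angular_derivative \<phi> \<zeta> \<longleftrightarrow> (\<exists>d. has_angular_derivative \<phi> \<zeta> d)"

text \<open>
  Twice continuous differentiability of \<open>\<phi>\<close>, extended to \<open>\<zeta>\<close> by its radial limit, as a function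
  on the disc together with \<open>\<zeta>\<close>; \<open>d2\<close> is the second derivative at \<open>\<zeta>\<close>. All derivatives are
  complex derivatives relative to this set, and they are unique because it has no isolated points.
  If there is no radial limit at \<open>\<zeta>\<close>, the extension is not continuous there for any
  value, so the predicate is false.
\<close>

definition has_second_derivative_at :: "(complex \<Rightarrow> complex) \<Rightarrow> complex \<Rightarrow> complex \<Rightarrow> bool" where
  "has_second_derivative_at \<phi> \<zeta> d2 \<longleftrightarrow>
     (\<exists>\<phi>1 \<phi>2.
        (\<forall>z\<in>insert \<zeta> \<D>.
           (\<phi>(\<zeta> := radial_limit \<phi> \<zeta>) has_field_derivative \<phi>1 z) (at z within insert \<zeta> \<D>)) \<and>
        (\<forall>z\<in>insert \<zeta> \<D>. (\<phi>1 has_field_derivative \<phi>2 z) (at z within insert \<zeta> \<D>)) \<and>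
        continuous_on (insert \<zeta> \<D>) \<phi>2 \<and>
        \<phi>2 \<zeta> = d2)"

definition second_order_data :: "(complex \<Rightarrow> complex) \<Rightarrow> complex \<Rightarrow> bool" where
  "second_order_data \<phi> \<zeta> \<longleftrightarrow> (\<exists>d2. has_second_derivative_at \<phi> \<zeta> d2)"

definition same_first_order_data ::
  "(complex \<Rightarrow> complex) \<Rightarrow> (complex \<Rightarrow> complex) \<Rightarrow> complex \<Rightarrow> bool" where
  "same_first_order_data \<phi> \<psi> \<zeta> \<longleftrightarrow>
     (\<exists>w. has_radial_limit \<phi> \<zeta> w \<and> has_radial_limit \<psi> \<zeta> w) \<and>
     (\<exists>d. has_angular_derivative \<phi> \<zeta> d \<and> has_angular_derivative \<psi> \<zeta> d)"

definition same_second_order_data ::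
  "(complex \<Rightarrow> complex) \<Rightarrow> (complex \<Rightarrow> complex) \<Rightarrow> complex \<Rightarrow> bool" where
  "same_second_order_data \<phi> \<psi> \<zeta> \<longleftrightarrow>
     same_first_order_data \<phi> \<psi> \<zeta> \<and>
     (\<exists>d2. has_second_derivative_at \<phi> \<zeta> d2 \<and> has_second_derivative_at \<psi> \<zeta> d2)"

end

theory Submission
  imports Defs
begin

text \<open>
  Point evaluation of the derivative at \<open>z\<close> has norm at most of order \<open>(1 - |z|\<^sup>2) ^ (- (\<gamma> + 2) / 2)\<close> on
  \<open>\<D>\<^sub>\<gamma>\<close>, and compactness of \<open>T = C\<^sub>\<phi> - C\<^sub>\<psi>\<close> makes \<open>(T f)' z\<close> negligible at that scale, uniformly over
  bounded \<open>f\<close>, as \<open>|z| \<rightarrow> 1\<close>. Testing this on normalised powers of \<open>1 / (1 - cnj (\<phi> z) u)\<close> gives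
  \<open>\<phi>' z - \<psi>' z * q z ^ m \<rightarrow> 0\<close> for two consecutive exponents \<open>m\<close>, where
  \<open>q = (1 - |\<phi>|\<^sup>2) / (1 - cnj \<phi> * \<psi>)\<close>, along every approach to the boundary on which \<open>1 - |\<phi>|\<close> is at
  most a multiple of \<open>1 - |z|\<close>; hence \<open>q \<rightarrow> 1\<close>. Radial approach yields equality of the values and first
  derivatives at \<open>\<zeta>\<close>. On an oricyclic approach \<open>1 - |\<phi>|\<close> is comparable to \<open>|z - \<zeta>|\<^sup>2\<close>, so \<open>q \<rightarrow> 1\<close> says that
  \<open>\<phi> - \<psi> = o(|z - \<zeta>|\<^sup>2)\<close>, which is equality of the second derivatives.
\<close>

subsection \<open>Derivative evaluation on weighted Dirichlet spaces\<close>

text \<open>The function \<open>y powr a * exp (- y)\<close> peaks at \<open>y = a\<close> with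
  value a^a exp(-a), of which the factor exp(-a) is dropped. Here \<open>exp (a * ln a)\<close> is
  a^a, equal to 1 at \<open>a = 0\<close>.\<close>

lemma powr_le_exp:
  fixes a y :: real
  assumes "a \<ge> 0" "y > 0"
  shows "y powr a \<le> exp (a * ln a) * exp y"
proof (cases "a = 0")
  case False
  then have a: "a > 0" using assms by simp
  have "ln (y / a) \<le> y / a - 1"
    using a assms by (intro ln_le_minus_one) auto
  then have "a * (ln y - ln a) \<le> a * (y / a - 1)"
    using a assms by (intro mult_left_mono) (auto simp: ln_div)
  then have "a * ln y \<le> a * ln a + y"
    using a by (simp add: algebra_simps)
  then show ?thesis
    using assms by (simp add: powr_def flip: exp_add)
qed (use assms in auto)

text \<open>With \<open>t = 1 - x\<close>, the powers of \<open>x\<close> decay at least like those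
  of \<open>exp (- t)\<close>. Half of this decay absorbs the weight at a cost of order
  \<open>t powr - a\<close>; the other half leaves a geometric series with sum of order
  \<open>1 / t\<close>.\<close>

lemma powr_series_bound:
  fixes a :: real
  assumes "a \<ge> 0"
  shows "\<exists>C>0. \<forall>x. 0 \<le> x \<and> x < 1 \<longrightarrow>
           summable (\<lambda>n. real (Suc n) powr a * x ^ n) \<and>
           (\<Sum>n. real (Suc n) powr a * x ^ n) \<le> C * (1 - x) powr - (a + 1)"
proof (intro exI conjI allI impI)
  let ?D = "exp (a * ln a)"
  define C where "C = 2 powr a * ?D * exp (1/2) * 4"
  show "C > 0" unfolding C_def by simp
  fix x :: real assume "0 \<le> x \<and> x < 1"
  then have x: "0 \<le> x" "x < 1" by auto
  define t where "t = 1 - x"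
  have t: "0 < t" "t \<le> 1" using x by (auto simp: t_def)
  define K where "K = (2 / t) powr a * ?D * exp (t / 2)"
  have K0: "K \<ge> 0" unfolding K_def by simp
  have term_le: "real (Suc n) powr a * x ^ n \<le> K * exp (- t / 2) ^ n" for n
  proof -
    \<comment> \<open>The rescaling makes the argument of \<open>powr_le_exp\<close> equal to
      \<open>t * real (Suc n) / 2\<close>, so that exactly half of the decay is spent on the
      weight.\<close>
    have "real (Suc n) powr a = ((2 / t) * (t * real (Suc n) / 2)) powr a"
      using t by (simp del: of_nat_Suc)
    also have "\<dots> = (2 / t) powr a * (t * real (Suc n) / 2) powr a"
      using t by (subst powr_mult) auto
    also have "\<dots> \<le> (2 / t) powr a * (?D * exp (t * real (Suc n) / 2))"
      using t assms by (intro mult_left_mono powr_le_exp) auto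
    finally have 1: "real (Suc n) powr a \<le> (2 / t) powr a * (?D * exp (t * real (Suc n) / 2))" .
    have "x \<le> exp (- t)" using exp_ge_add_one_self[of "- t"] by (simp add: t_def)
    then have 2: "x ^ n \<le> exp (- t) ^ n" using x by (intro power_mono)
    have "real (Suc n) powr a * x ^ n \<le>
        (2 / t) powr a * (?D * exp (t * real (Suc n) / 2)) * exp (- t) ^ n"
      using 1 2 x by (intro mult_mono) auto
    also have "\<dots> = (2 / t) powr a * ?D * (exp (t * real (Suc n) / 2) * exp (- t) ^ n)"
      by simp
    also have "exp (t * real (Suc n) / 2) * exp (- t) ^ n = exp (t / 2) * exp (- t / 2) ^ n"
      by (simp flip: exp_of_nat_mult exp_add add: field_simps)
    finally show ?thesis unfolding K_def by simp
  qed
  have e: "exp (- t / 2) < 1" using t by simp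
  have sum_e: "summable (\<lambda>n. K * exp (- t / 2) ^ n)"
    using e by (intro summable_mult summable_geometric) auto
  show sm: "summable (\<lambda>n. real (Suc n) powr a * x ^ n)"
    using x term_le by (intro summable_comparison_test'[OF sum_e, of 0]) auto
  have "(\<Sum>n. real (Suc n) powr a * x ^ n) \<le> (\<Sum>n. K * exp (- t / 2) ^ n)"
    by (intro suminf_le term_le sm sum_e)
  also have "\<dots> = K * (1 / (1 - exp (- t / 2)))"
    using e by (subst suminf_mult) (auto intro!: summable_geometric simp: suminf_geometric)
  also have "\<dots> \<le> K * (4 / t)"
  proof (intro mult_left_mono K0)
    have "1 + t / 2 \<le> exp (t / 2)" by simp
    then have "exp (- t / 2) \<le> 1 / (1 + t / 2)"
      using t by (simp add: exp_minus field_simps)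
    \<comment> \<open>Cleared of its denominator this is \<open>t * t \<le> 2 * t\<close>, which
      follows from \<open>t \<le> 1\<close>.\<close>
    also have "1 / (1 + t / 2) \<le> 1 - t / 4"
      using t mult_left_mono[of t 1 t] by (simp add: field_simps)
    finally have "t / 4 \<le> 1 - exp (- t / 2)" by simp
    then show "1 / (1 - exp (- t / 2)) \<le> 4 / t"
      using t by (simp add: field_simps)
  qed
  also have "K \<le> (2 / t) powr a * ?D * exp (1/2)"
    unfolding K_def using t by (intro mult_left_mono) auto
  then have "K * (4 / t) \<le> (2 / t) powr a * ?D * exp (1/2) * (4 / t)"
    using t by (intro mult_right_mono) auto
  also have "\<dots> = C * t powr - (a + 1)"
  proof -
    have "t powr - (a + 1) = 1 / (t powr a * t)"
      using t by (simp only: powr_minus_divide powr_add) simp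
    then show ?thesis using t by (simp add: C_def powr_divide)
  qed
  finally show "(\<Sum>n. real (Suc n) powr a * x ^ n) \<le> C * (1 - x) powr - (a + 1)"
    by (simp add: t_def)
qed

section \<open>Head and tail of the Taylor series of the derivative\<close>

lemma deriv_sums_taylor_coeff:
  assumes "f holomorphic_on \<D>" "z \<in> \<D>"
  shows "(\<lambda>n. of_nat (Suc n) * taylor_coeff f (Suc n) * z ^ n) sums deriv f z"
proof -
  have "(deriv ^^ n) (deriv f) 0 / fact n = of_nat (Suc n) * taylor_coeff f (Suc n)" for n
    by (simp add: taylor_coeff_def funpow_swap1 field_simps del: of_nat_Suc)
  moreover have "deriv f holomorphic_on \<D>"
    using assms by (intro holomorphic_deriv) auto
  ultimately show ?thesis
    using holomorphic_power_series[of "deriv f" 0 1 z] assms by simp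
qed

text \<open>The head is estimated crudely by \<open>cmod z \<le> 1\<close>. The tail is treated by
  Cauchy-Schwarz after splitting \<open>real (Suc n)\<close> into its powers with exponents
  \<open>(1 - \<gamma>) / 2\<close> and \<open>(1 + \<gamma>) / 2\<close>. The cut \<open>M\<close>
  is free: 0 leads to a norm bound, while a large \<open>M\<close> makes the tail small for a fixed
  \<open>f\<close>.\<close>

lemma deriv_head_tail_bound:
  assumes f: "f \<in> dirichlet_space \<gamma>" and z: "z \<in> \<D>"
    and sm: "summable (\<lambda>n. real (Suc n) powr (1 + \<gamma>) * ((cmod z)\<^sup>2) ^ n)"
  shows "cmod (deriv f z) \<le> (\<Sum>n<M. real (Suc n) * cmod (taylor_coeff f (Suc n))) +
     sqrt (\<Sum>n. real (Suc (n + M)) powr (1 - \<gamma>) * (cmod (taylor_coeff f (Suc (n + M))))\<^sup>2) *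
     sqrt (\<Sum>n. real (Suc n) powr (1 + \<gamma>) * ((cmod z)\<^sup>2) ^ n)"
proof -
  define c where "c n = cmod (taylor_coeff f (Suc n))" for n
  define W where "W n = real (Suc n) powr (1 - \<gamma>) * (c n)\<^sup>2" for n
  define V where "V n = real (Suc n) powr (1 + \<gamma>) * ((cmod z)\<^sup>2) ^ n" for n
  have hol: "f holomorphic_on \<D>" and sW: "summable W"
    using f by (auto simp: dirichlet_space_def W_def[abs_def] c_def)
  have c0: "c n \<ge> 0" and W0: "W n \<ge> 0" and V0: "V n \<ge> 0" for n
    by (auto simp: c_def W_def V_def)
  have sW': "summable (\<lambda>n. W (n + M))" using sW by simp
  have sV: "summable V" using sm by (simp add: V_def[abs_def])
  have z1: "cmod z \<le> 1" using z by simp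
  have split: "real (Suc n) * c n * cmod z ^ n = sqrt (W n) * sqrt (V n)" for n
  proof -
    have "W n * V n = real (Suc n) powr ((1 - \<gamma>) + (1 + \<gamma>)) * ((c n)\<^sup>2 * ((cmod z)\<^sup>2) ^ n)"
      unfolding W_def V_def powr_add by simp
    also have "real (Suc n) powr ((1 - \<gamma>) + (1 + \<gamma>)) = (real (Suc n))\<^sup>2"
      by (simp del: of_nat_Suc)
    also have "\<dots> * ((c n)\<^sup>2 * ((cmod z)\<^sup>2) ^ n) = (real (Suc n) * c n * cmod z ^ n)\<^sup>2"
      by (simp add: power_mult_distrib power2_eq_square)
    finally show ?thesis using c0[of n] by (simp flip: real_sqrt_mult del: of_nat_Suc)
  qed
  have partial: "cmod (\<Sum>n<N. of_nat (Suc n) * taylor_coeff f (Suc n) * z ^ n) \<le>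
     (\<Sum>n<M. real (Suc n) * c n) + sqrt (\<Sum>n. W (n + M)) * sqrt (\<Sum>n. V n)" if "N \<ge> M" for N
  proof -
    have "cmod (\<Sum>n<N. of_nat (Suc n) * taylor_coeff f (Suc n) * z ^ n) \<le>
        (\<Sum>n<N. real (Suc n) * c n * cmod z ^ n)"
      by (rule order_trans[OF norm_sum])
        (simp add: norm_mult norm_power c_def del: of_nat_Suc)
    also have "\<dots> = (\<Sum>n\<in>{..<M} \<union> {M..<N}. real (Suc n) * c n * cmod z ^ n)"
      using that by (simp only: ivl_disj_un)
    also have "\<dots> = (\<Sum>n<M. real (Suc n) * c n * cmod z ^ n) + (\<Sum>n=M..<N. sqrt (W n) * sqrt (V n))"
      by (subst sum.union_disjoint) (auto simp: split simp del: of_nat_Suc)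
    also have "(\<Sum>n<M. real (Suc n) * c n * cmod z ^ n) \<le> (\<Sum>n<M. real (Suc n) * c n)"
      using z1 c0 by (intro sum_mono mult_left_le) (auto intro: power_le_one)
    also have "(\<Sum>n=M..<N. sqrt (W n) * sqrt (V n)) \<le>
        (\<Sum>n=M..<N. \<bar>sqrt (W n)\<bar> * \<bar>sqrt (V n)\<bar>)"
      using W0 V0 by (intro sum_mono) auto
    also have "\<dots> \<le> L2_set (\<lambda>n. sqrt (W n)) {M..<N} * L2_set (\<lambda>n. sqrt (V n)) {M..<N}"
      by (rule L2_set_mult_ineq)
    also have "\<dots> = sqrt (\<Sum>n=M..<N. W n) * sqrt (\<Sum>n=M..<N. V n)"
      using W0 V0 by (simp add: L2_set_def)
    also have "\<dots> \<le> sqrt (\<Sum>n. W (n + M)) * sqrt (\<Sum>n. V n)"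
    proof (intro mult_mono real_sqrt_le_mono)
      have "(\<Sum>n=M..<N. W n) = (\<Sum>n<N - M. W (n + M))"
        using sum.shift_bounds_nat_ivl[of W 0 M "N - M"] that by (simp add: lessThan_atLeast0)
      also have "\<dots> \<le> (\<Sum>n. W (n + M))" by (intro sum_le_suminf sW') (auto simp: W0)
      finally show "(\<Sum>n=M..<N. W n) \<le> (\<Sum>n. W (n + M))" .
      show "(\<Sum>n=M..<N. V n) \<le> (\<Sum>n. V n)" by (intro sum_le_suminf sV) (auto simp: V0)
    qed (use W0 V0 sW' in \<open>auto intro!: sum_nonneg suminf_nonneg\<close>)
    finally show ?thesis by simp
  qed
  have "(\<lambda>N. cmod (\<Sum>n<N. of_nat (Suc n) * taylor_coeff f (Suc n) * z ^ n)) \<longlonglongrightarrow> cmod (deriv f z)"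
    using deriv_sums_taylor_coeff[OF hol z] unfolding sums_def by (rule tendsto_norm)
  then have "cmod (deriv f z) \<le> (\<Sum>n<M. real (Suc n) * c n) + sqrt (\<Sum>n. W (n + M)) * sqrt (\<Sum>n. V n)"
    using partial by (intro LIMSEQ_le_const2) blast+
  then show ?thesis by (simp add: c_def W_def V_def)
qed

lemma taylor_coeff_diff:
  assumes "f holomorphic_on \<D>" "g holomorphic_on \<D>"
  shows "taylor_coeff (\<lambda>z. f z - g z) n = taylor_coeff f n - taylor_coeff g n"
  using higher_deriv_diff[OF assms, of 0 n] by (simp add: taylor_coeff_def diff_divide_distrib)

lemma dirichlet_space_diff:
  assumes "f \<in> dirichlet_space \<gamma>" "g \<in> dirichlet_space \<gamma>"
  shows "(\<lambda>z. f z - g z) \<in> dirichlet_space \<gamma>"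
proof -
  define W where "W n = real (Suc n) powr (1 - \<gamma>)" for n
  have hol: "f holomorphic_on \<D>" "g holomorphic_on \<D>"
    and sf: "summable (\<lambda>n. W n * (cmod (taylor_coeff f (Suc n)))\<^sup>2)"
    and sg: "summable (\<lambda>n. W n * (cmod (taylor_coeff g (Suc n)))\<^sup>2)"
    using assms by (auto simp: dirichlet_space_def W_def)
  have "summable (\<lambda>n. 2 * (W n * (cmod (taylor_coeff f (Suc n)))\<^sup>2 + W n * (cmod (taylor_coeff g (Suc n)))\<^sup>2))"
    by (intro summable_mult summable_add sf sg)
  then have "summable (\<lambda>n. W n * (cmod (taylor_coeff (\<lambda>z. f z - g z) (Suc n)))\<^sup>2)"
  proof (rule summable_comparison_test'[where N = 0])
    fix n
    have ineq: "(cmod (a - b))\<^sup>2 \<le> 2 * ((cmod a)\<^sup>2 + (cmod b)\<^sup>2)" for a b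
    proof -
      have "(cmod (a - b))\<^sup>2 \<le> (cmod a + cmod b)\<^sup>2"
        by (intro power_mono norm_triangle_ineq4) auto
      also have "\<dots> \<le> 2 * ((cmod a)\<^sup>2 + (cmod b)\<^sup>2)"
        using sum_squares_bound[of "cmod a" "cmod b"] by (simp add: power2_sum)
      finally show ?thesis .
    qed
    show "norm (W n * (cmod (taylor_coeff (\<lambda>z. f z - g z) (Suc n)))\<^sup>2) \<le>
        2 * (W n * (cmod (taylor_coeff f (Suc n)))\<^sup>2 + W n * (cmod (taylor_coeff g (Suc n)))\<^sup>2)"
      using mult_left_mono[OF ineq[of "taylor_coeff f (Suc n)" "taylor_coeff g (Suc n)"], of "W n"]
      by (simp add: taylor_coeff_diff[OF hol] W_def algebra_simps del: of_nat_Suc)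
  qed
  then show ?thesis
    using hol by (auto simp: dirichlet_space_def W_def intro!: holomorphic_intros)
qed

text \<open>By \<open>powr_series_bound\<close> with exponent \<open>1 + \<gamma>\<close>,
  nonnegative since \<open>\<gamma> \<ge> - 1\<close>, the second Cauchy-Schwarz factor is at most a
  multiple of \<open>(1 - (cmod z)\<^sup>2) powr (- (\<gamma> + 2) / 2)\<close>, which the weight
  cancels. One constant serves all \<open>f\<close>, \<open>z\<close> and \<open>M\<close>.\<close>

lemma dirichlet_deriv_head_tail:
  fixes \<gamma> :: real
  assumes "\<gamma> \<ge> - 1"
  shows "\<exists>C>0. \<forall>f\<in>dirichlet_space \<gamma>. \<forall>z\<in>\<D>. \<forall>M.
     (1 - (cmod z)\<^sup>2) powr ((\<gamma> + 2) / 2) * cmod (deriv f z) \<le>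
     (1 - (cmod z)\<^sup>2) powr ((\<gamma> + 2) / 2) * (\<Sum>n<M. real (Suc n) * cmod (taylor_coeff f (Suc n))) +
     C * sqrt (\<Sum>n. real (Suc (n + M)) powr (1 - \<gamma>) * (cmod (taylor_coeff f (Suc (n + M))))\<^sup>2)"
proof -
  obtain C where C: "C > 0" and
    CC: "\<And>x. 0 \<le> x \<Longrightarrow> x < 1 \<Longrightarrow> summable (\<lambda>n. real (Suc n) powr (1 + \<gamma>) * x ^ n) \<and>
           (\<Sum>n. real (Suc n) powr (1 + \<gamma>) * x ^ n) \<le> C * (1 - x) powr - (1 + \<gamma> + 1)"
    using powr_series_bound[of "1 + \<gamma>"] assms by auto
  show ?thesis
  proof (intro exI[of _ "sqrt C"] conjI ballI allI)
    show "sqrt C > 0" using C by simp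
    fix f z M assume f: "f \<in> dirichlet_space \<gamma>" and z: "z \<in> \<D>"
    define H where "H = (\<Sum>n<M. real (Suc n) * cmod (taylor_coeff f (Suc n)))"
    define R where "R = (\<Sum>n. real (Suc (n + M)) powr (1 - \<gamma>) * (cmod (taylor_coeff f (Suc (n + M))))\<^sup>2)"
    define t where "t = 1 - (cmod z)\<^sup>2"
    have x: "0 \<le> (cmod z)\<^sup>2" "(cmod z)\<^sup>2 < 1" using z by (auto simp: abs_square_less_1)
    then have t: "t > 0" by (simp add: t_def)
    have "summable (\<lambda>n. real (Suc n) powr (1 - \<gamma>) * (cmod (taylor_coeff f (Suc n)))\<^sup>2)"
      using f by (simp add: dirichlet_space_def)
    from summable_ignore_initial_segment[OF this, of M] have R: "R \<ge> 0"
      unfolding R_def by (intro suminf_nonneg) auto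
    have "cmod (deriv f z) \<le> H + sqrt R * sqrt (\<Sum>n. real (Suc n) powr (1 + \<gamma>) * ((cmod z)\<^sup>2) ^ n)"
      using deriv_head_tail_bound[OF f z, of M] CC[OF x] by (simp add: H_def R_def)
    also have "\<dots> \<le> H + sqrt R * sqrt (C * t powr - (\<gamma> + 2))"
      using CC[OF x] R by (intro add_left_mono mult_left_mono real_sqrt_le_mono) (auto simp: t_def add_ac)
    also have "sqrt (C * t powr - (\<gamma> + 2)) = sqrt C * t powr (- (\<gamma> + 2) / 2)"
      using t by (simp add: real_sqrt_mult powr_half_sqrt[symmetric] powr_powr)
    finally have "t powr ((\<gamma> + 2) / 2) * cmod (deriv f z) \<le>
        t powr ((\<gamma> + 2) / 2) * (H + sqrt R * (sqrt C * t powr (- (\<gamma> + 2) / 2)))"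
      by (intro mult_left_mono) auto
    also have "\<dots> = t powr ((\<gamma> + 2) / 2) * H +
        sqrt C * sqrt R * (t powr ((\<gamma> + 2) / 2) * t powr (- (\<gamma> + 2) / 2))"
      by (simp add: algebra_simps)
    also have "t powr ((\<gamma> + 2) / 2) * t powr (- (\<gamma> + 2) / 2) = 1"
      using t by (simp flip: powr_add add: field_simps)
    finally show "(1 - (cmod z)\<^sup>2) powr ((\<gamma> + 2) / 2) * cmod (deriv f z) \<le>
        (1 - (cmod z)\<^sup>2) powr ((\<gamma> + 2) / 2) * (\<Sum>n<M. real (Suc n) * cmod (taylor_coeff f (Suc n))) +
        sqrt C * sqrt (\<Sum>n. real (Suc (n + M)) powr (1 - \<gamma>) * (cmod (taylor_coeff f (Suc (n + M))))\<^sup>2)"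
      by (simp add: t_def H_def R_def)
  qed
qed

text \<open>For \<open>M = 0\<close> the head is empty, and the tail is the norm without the
  contribution of \<open>taylor_coeff f 0\<close>.\<close>

lemma dirichlet_deriv_bound:
  fixes \<gamma> :: real
  assumes "\<gamma> \<ge> - 1"
  shows "\<exists>C>0. \<forall>f\<in>dirichlet_space \<gamma>. \<forall>z\<in>\<D>.
     (1 - (cmod z)\<^sup>2) powr ((\<gamma> + 2) / 2) * cmod (deriv f z) \<le> C * dirichlet_norm \<gamma> f"
proof -
  obtain C where C: "C > 0" and
    CC: "\<forall>f\<in>dirichlet_space \<gamma>. \<forall>z\<in>\<D>. \<forall>M.
     (1 - (cmod z)\<^sup>2) powr ((\<gamma> + 2) / 2) * cmod (deriv f z) \<le>
     (1 - (cmod z)\<^sup>2) powr ((\<gamma> + 2) / 2) * (\<Sum>n<M. real (Suc n) * cmod (taylor_coeff f (Suc n))) +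
     C * sqrt (\<Sum>n. real (Suc (n + M)) powr (1 - \<gamma>) * (cmod (taylor_coeff f (Suc (n + M))))\<^sup>2)"
    using dirichlet_deriv_head_tail[OF assms] by blast
  have *: "(1 - (cmod z)\<^sup>2) powr ((\<gamma> + 2) / 2) * cmod (deriv f z) \<le>
      C * sqrt (\<Sum>n. real (Suc n) powr (1 - \<gamma>) * (cmod (taylor_coeff f (Suc n)))\<^sup>2)"
    if "f \<in> dirichlet_space \<gamma>" "z \<in> \<D>" for f z
    using CC[rule_format, OF that, of 0] by simp
  show ?thesis
  proof (intro exI[of _ C] conjI ballI C)
    fix f z assume "f \<in> dirichlet_space \<gamma>" "z \<in> \<D>"
    note *[OF this]
    also have "C * sqrt (\<Sum>n. real (Suc n) powr (1 - \<gamma>) * (cmod (taylor_coeff f (Suc n)))\<^sup>2) \<le>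
        C * dirichlet_norm \<gamma> f"
      unfolding dirichlet_norm_def using C by (intro mult_left_mono real_sqrt_le_mono) auto
    finally show "(1 - (cmod z)\<^sup>2) powr ((\<gamma> + 2) / 2) * cmod (deriv f z) \<le> C * dirichlet_norm \<gamma> f" .
  qed
qed

text \<open>For fixed \<open>f\<close> a cut \<open>M\<close> is chosen that makes the tail small.
  The head is then a fixed number, and the weight in front of it tends to 0 because its exponent is
  positive.\<close>

lemma dirichlet_deriv_vanishes:
  fixes \<gamma> :: real
  assumes \<gamma>: "\<gamma> \<ge> - 1" and f: "f \<in> dirichlet_space \<gamma>"
    and z: "\<And>n. z n \<in> \<D>" "(\<lambda>n. cmod (z n)) \<longlonglongrightarrow> 1"
  shows "(\<lambda>n. (1 - (cmod (z n))\<^sup>2) powr ((\<gamma> + 2) / 2) * cmod (deriv f (z n))) \<longlonglongrightarrow> 0"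
proof (rule tendstoI)
  fix e :: real assume e: "e > 0"
  obtain C where C: "C > 0" and
    *: "\<And>z M. z \<in> \<D> \<Longrightarrow>
      (1 - (cmod z)\<^sup>2) powr ((\<gamma> + 2) / 2) * cmod (deriv f z) \<le>
      (1 - (cmod z)\<^sup>2) powr ((\<gamma> + 2) / 2) * (\<Sum>n<M. real (Suc n) * cmod (taylor_coeff f (Suc n))) +
      C * sqrt (\<Sum>n. real (Suc (n + M)) powr (1 - \<gamma>) * (cmod (taylor_coeff f (Suc (n + M))))\<^sup>2)"
    using dirichlet_deriv_head_tail[OF \<gamma>] f by blast
  define R where "R M = (\<Sum>n. real (Suc (n + M)) powr (1 - \<gamma>) * (cmod (taylor_coeff f (Suc (n + M))))\<^sup>2)" for M
  have "summable (\<lambda>n. real (Suc n) powr (1 - \<gamma>) * (cmod (taylor_coeff f (Suc n)))\<^sup>2)"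
    using f by (simp add: dirichlet_space_def)
  then have "R \<longlonglongrightarrow> 0"
    unfolding R_def[abs_def] by (rule suminf_exist_split2)
  then have "(\<lambda>M. C * sqrt (R M)) \<longlonglongrightarrow> C * sqrt 0"
    by (intro tendsto_intros)
  then have "\<forall>\<^sub>F M in sequentially. C * sqrt (R M) < e / 2"
    using e by (intro order_tendstoD(2)) auto
  then obtain M where M: "C * sqrt (R M) < e / 2"
    by (auto simp: eventually_sequentially)
  define H where "H = (\<Sum>n<M. real (Suc n) * cmod (taylor_coeff f (Suc n)))"
  have "(\<lambda>n. (1 - (cmod (z n))\<^sup>2) powr ((\<gamma> + 2) / 2) * H) \<longlonglongrightarrow> (1 - 1\<^sup>2) powr ((\<gamma> + 2) / 2) * H"
    using \<gamma> z by (intro tendsto_mult tendsto_powr2 tendsto_intros always_eventually)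
      (auto simp: abs_square_le_1 less_imp_le)
  then have "\<forall>\<^sub>F n in sequentially. (1 - (cmod (z n))\<^sup>2) powr ((\<gamma> + 2) / 2) * H < e / 2"
    using e by (intro order_tendstoD(2)) auto
  then show "\<forall>\<^sub>F n in sequentially.
      dist ((1 - (cmod (z n))\<^sup>2) powr ((\<gamma> + 2) / 2) * cmod (deriv f (z n))) 0 < e"
  proof eventually_elim
    case (elim n)
    with *[OF z(1), of n M] M show ?case by (simp add: H_def R_def)
  qed
qed

section \<open>Compact operators and derivative evaluation\<close>

text \<open>If the quantity stayed above some \<open>e\<close> along a subsequence, compactness
  would make the images converge in norm to a single \<open>g\<close> along a further one. There
  \<open>dirichlet_deriv_bound\<close> controls the difference from \<open>g\<close> and
  \<open>dirichlet_deriv_vanishes\<close> controls \<open>g\<close> itself, which contradicts the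
  lower bound \<open>e\<close>.\<close>

lemma compact_operator_deriv_vanishes:
  fixes \<gamma> :: real
  assumes \<gamma>: "\<gamma> \<ge> - 1" and T: "compact_operator_on \<gamma> T"
    and s: "\<And>n. s n \<in> dirichlet_space \<gamma>" "\<And>n. dirichlet_norm \<gamma> (s n) \<le> B"
    and z: "\<And>n. z n \<in> \<D>" "(\<lambda>n. cmod (z n)) \<longlonglongrightarrow> 1"
  shows "(\<lambda>n. (1 - (cmod (z n))\<^sup>2) powr ((\<gamma> + 2) / 2) * cmod (deriv (T (s n)) (z n))) \<longlonglongrightarrow> 0"
    (is "?X \<longlonglongrightarrow> 0")
proof (rule ccontr)
  assume "\<not> ?X \<longlonglongrightarrow> 0"
  then obtain e where e: "e > 0" and fr: "\<not> (\<forall>\<^sub>F n in sequentially. dist (?X n) 0 < e)"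
    by (auto simp: tendsto_iff)
  define S where "S = {n. \<not> dist (?X n) 0 < e}"
  have "infinite S"
    using fr by (simp add: S_def eventually_cofinite flip: cofinite_eq_sequentially)
  then obtain r :: "nat \<Rightarrow> nat" where r: "strict_mono r" "\<And>n. r n \<in> S"
    using infinite_enumerate by blast
  have rX: "?X (r n) \<ge> e" for n
    using r(2)[of n] by (simp add: S_def)
  have maps: "\<And>f. f \<in> dirichlet_space \<gamma> \<Longrightarrow> T f \<in> dirichlet_space \<gamma>"
    using T by (simp add: compact_operator_on_def)
  obtain r' g where r': "strict_mono r'" and g: "g \<in> dirichlet_space \<gamma>"
    and lim: "(\<lambda>n. dirichlet_norm \<gamma> (\<lambda>z. T (s (r (r' n))) z - g z)) \<longlonglongrightarrow> 0"
  proof -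
    have "(\<forall>n. (s \<circ> r) n \<in> dirichlet_space \<gamma>) \<and> (\<exists>B. \<forall>n. dirichlet_norm \<gamma> ((s \<circ> r) n) \<le> B)"
      using s by auto
    with T obtain r' g where "strict_mono r'" "g \<in> dirichlet_space \<gamma>"
      "(\<lambda>n. dirichlet_norm \<gamma> (\<lambda>z. T ((s \<circ> r) (r' n)) z - g z)) \<longlonglongrightarrow> 0"
      unfolding compact_operator_on_def by blast
    then show ?thesis using that by simp
  qed
  define q where "q n = r (r' n)" for n
  have q: "strict_mono q" using r(1) r' by (auto simp: q_def strict_mono_def)
  obtain C where C: "\<And>f z. f \<in> dirichlet_space \<gamma> \<Longrightarrow> z \<in> \<D> \<Longrightarrow>
     (1 - (cmod z)\<^sup>2) powr ((\<gamma> + 2) / 2) * cmod (deriv f z) \<le> C * dirichlet_norm \<gamma> f"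
    using dirichlet_deriv_bound[OF \<gamma>] by blast
  have ub: "?X (q n) \<le> C * dirichlet_norm \<gamma> (\<lambda>z. T (s (q n)) z - g z) +
      (1 - (cmod (z (q n)))\<^sup>2) powr ((\<gamma> + 2) / 2) * cmod (deriv g (z (q n)))" for n
  proof -
    have "T (s (q n)) field_differentiable at (z (q n))" "g field_differentiable at (z (q n))"
      using maps[OF s(1)] g z by (auto simp: dirichlet_space_def intro!: holomorphic_on_imp_differentiable_at)
    then have "deriv (T (s (q n))) (z (q n)) =
        deriv (\<lambda>z. T (s (q n)) z - g z) (z (q n)) + deriv g (z (q n))"
      by (simp add: deriv_diff)
    then have "?X (q n) \<le> (1 - (cmod (z (q n)))\<^sup>2) powr ((\<gamma> + 2) / 2) *
        (cmod (deriv (\<lambda>z. T (s (q n)) z - g z) (z (q n))) + cmod (deriv g (z (q n))))"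
      by (auto intro!: mult_left_mono norm_triangle_ineq)
    with C[OF dirichlet_space_diff[OF maps[OF s(1)] g] z(1), of "q n" "q n"] show ?thesis
      by (simp add: algebra_simps)
  qed
  have "(\<lambda>n. cmod (z (q n))) \<longlonglongrightarrow> 1"
    using LIMSEQ_subseq_LIMSEQ[OF z(2) q] by (simp add: o_def)
  then have "(\<lambda>n. C * dirichlet_norm \<gamma> (\<lambda>z. T (s (q n)) z - g z) +
      (1 - (cmod (z (q n)))\<^sup>2) powr ((\<gamma> + 2) / 2) * cmod (deriv g (z (q n)))) \<longlonglongrightarrow> C * 0 + 0"
    using lim unfolding q_def[symmetric]
    by (intro tendsto_add tendsto_mult tendsto_const dirichlet_deriv_vanishes[OF \<gamma> g] z)
  moreover have "e \<le> C * dirichlet_norm \<gamma> (\<lambda>z. T (s (q n)) z - g z) +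
      (1 - (cmod (z (q n)))\<^sup>2) powr ((\<gamma> + 2) / 2) * cmod (deriv g (z (q n)))" for n
    using order_trans[OF rX[of "r' n"] ub[of n, unfolded q_def]] by (simp add: q_def)
  ultimately have "e \<le> C * 0 + 0"
    by (intro LIMSEQ_le_const) auto
  with e show False by simp
qed

subsection \<open>Test functions\<close>

lemma one_minus_mult_nonzero:
  fixes c u :: complex
  assumes "cmod c < 1" "cmod u < 1"
  shows "1 - c * u \<noteq> 0"
proof
  assume "1 - c * u = 0"
  then have "cmod (c * u) = 1" by simp
  moreover have "cmod (c * u) < 1"
    using assms mult_strict_mono[of "cmod c" 1 "cmod u" 1] by (simp add: norm_mult)
  ultimately show False by simp
qed

lemma deriv_inverse_power:
  fixes c u :: complex
  assumes "cmod c < 1" "cmod u < 1"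
  shows "((\<lambda>u. inverse (1 - c * u) ^ m) has_field_derivative
           of_nat m * c * inverse (1 - c * u) ^ Suc m) (at u)"
proof (cases m)
  case (Suc k)
  have "((\<lambda>u. inverse (1 - c * u)) has_field_derivative c * inverse (1 - c * u) ^ 2) (at u)"
    using one_minus_mult_nonzero[OF assms]
    by (auto intro!: derivative_eq_intros simp: power2_eq_square)
  from DERIV_power[OF this, of m] show ?thesis
    unfolding Suc by (simp add: power2_eq_square mult_ac)
qed auto

lemma higher_deriv_inverse_power:
  fixes c u :: complex
  assumes c: "cmod c < 1" and u: "u \<in> \<D>"
  shows "(deriv ^^ n) (\<lambda>u. inverse (1 - c * u) ^ m) u =
           pochhammer (of_nat m) n * c ^ n * inverse (1 - c * u) ^ (m + n)"
  using u
proof (induction n arbitrary: u)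
  case (Suc n)
  let ?g = "\<lambda>u. pochhammer (of_nat m) n * c ^ n * inverse (1 - c * u) ^ (m + n)"
  have "\<forall>\<^sub>F v in nhds u. v \<in> \<D>"
    using Suc.prems by (intro eventually_nhds_in_open) auto
  then have "deriv ((deriv ^^ n) (\<lambda>u. inverse (1 - c * u) ^ m)) u = deriv ?g u"
    by (intro deriv_cong_ev) (auto elim: eventually_mono simp: Suc.IH)
  also have "deriv ?g u = pochhammer (of_nat m) n * c ^ n *
      (of_nat (m + n) * c * inverse (1 - c * u) ^ Suc (m + n))"
    using c Suc.prems by (intro DERIV_imp_deriv DERIV_cmult deriv_inverse_power) auto
  also have "\<dots> = pochhammer (of_nat m) (Suc n) * c ^ Suc n * inverse (1 - c * u) ^ (m + Suc n)"
    by (simp add: pochhammer_Suc)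
  finally show ?case by simp
qed simp

text \<open>The quotient is the binomial coefficient n + k over k. Passing from \<open>k\<close> to
  \<open>Suc k\<close> multiplies it by (k + 1 + n) / (k + 1), which is at most n + 1.\<close>

lemma pochhammer_fact_le: "pochhammer (real (Suc k)) n / fact n \<le> real (Suc n) ^ k"
proof (induction k)
  case 0
  show ?case using pochhammer_fact[of n, where 'a = real] by simp
next
  case (Suc k)
  define A where "A = pochhammer (real (Suc (Suc k))) n"
  define B where "B = pochhammer (real (Suc k)) n"
  \<comment> \<open>Both sides are the rising factorial of \<open>Suc k\<close> of length
    \<open>Suc n\<close>, split at its first and at its last factor.\<close>
  have "real (Suc k) * A = (real (Suc k) + real n) * B"
    using pochhammer_rec[of "real (Suc k)" n] pochhammer_rec'[of "real (Suc k)" n]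
    by (simp add: A_def B_def add_ac)
  then have "A = (real (Suc k) + real n) / real (Suc k) * B"
    by (simp add: field_simps del: of_nat_Suc)
  then have "pochhammer (real (Suc (Suc k))) n / fact n =
      (real (Suc k) + real n) / real (Suc k) * (pochhammer (real (Suc k)) n / fact n)"
    by (simp add: A_def[symmetric] B_def[symmetric] del: of_nat_Suc)
  also have "\<dots> \<le> real (Suc n) * real (Suc n) ^ k"
  proof (intro mult_mono Suc.IH)
    show "(real (Suc k) + real n) / real (Suc k) \<le> real (Suc n)"
      by (simp add: field_simps)
  qed (auto intro!: divide_nonneg_nonneg pochhammer_nonneg)
  finally show ?case by simp
qed

lemma dirichlet_scale:
  assumes f: "f \<in> dirichlet_space \<gamma>"
  shows "(\<lambda>z. c * f z) \<in> dirichlet_space \<gamma>"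
    and "dirichlet_norm \<gamma> (\<lambda>z. c * f z) = cmod c * dirichlet_norm \<gamma> f"
proof -
  have hol: "f holomorphic_on \<D>" using f by (simp add: dirichlet_space_def)
  have tc: "taylor_coeff (\<lambda>z. c * f z) n = c * taylor_coeff f n" for n
    using higher_deriv_cmult[OF hol, of 0 n c] by (simp add: taylor_coeff_def)
  define W where "W n = real (Suc n) powr (1 - \<gamma>) * (cmod (taylor_coeff f (Suc n)))\<^sup>2" for n
  have W: "summable W" using f by (simp add: dirichlet_space_def W_def[abs_def])
  have eq: "real (Suc n) powr (1 - \<gamma>) * (cmod (taylor_coeff (\<lambda>z. c * f z) (Suc n)))\<^sup>2 =
      (cmod c)\<^sup>2 * W n" for n
    by (simp add: tc W_def norm_mult power_mult_distrib)
  show "(\<lambda>z. c * f z) \<in> dirichlet_space \<gamma>"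
    using hol summable_mult[OF W, of "(cmod c)\<^sup>2"]
    by (auto intro!: holomorphic_intros simp: dirichlet_space_def eq simp del: of_nat_Suc)
  have "dirichlet_norm \<gamma> (\<lambda>z. c * f z) =
      sqrt ((cmod c)\<^sup>2 * ((cmod (taylor_coeff f 0))\<^sup>2 + (\<Sum>n. W n)))"
    unfolding dirichlet_norm_def eq
    by (simp add: suminf_mult[OF W] tc norm_mult power_mult_distrib distrib_left)
  then show "dirichlet_norm \<gamma> (\<lambda>z. c * f z) = cmod c * dirichlet_norm \<gamma> f"
    by (simp add: real_sqrt_mult dirichlet_norm_def W_def[abs_def])
qed

text \<open>The n-th Taylor coefficient is at most of order n^k |c|^n, so
  \<open>powr_series_bound\<close> with exponent \<open>a = 2 * real k + 1 - \<gamma>\<close>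
  governs the squared norm; the assumption on \<open>k\<close> says \<open>a \<ge> 0\<close>. Taking
  the root leaves the exponent \<open>- (a + 1) / 2\<close>, the one in the statement.\<close>

lemma dirichlet_norm_inverse_power:
  fixes \<gamma> :: real
  assumes k: "2 * real k + 1 - \<gamma> \<ge> 0"
  shows "\<exists>C>0. \<forall>c. cmod c < 1 \<longrightarrow>
     (\<lambda>u. inverse (1 - c * u) ^ Suc k) \<in> dirichlet_space \<gamma> \<and>
     dirichlet_norm \<gamma> (\<lambda>u. inverse (1 - c * u) ^ Suc k) \<le>
       C * (1 - (cmod c)\<^sup>2) powr - (real k + 1 - \<gamma> / 2)"
proof -
  define a where "a = 2 * real k + 1 - \<gamma>"
  obtain C where C: "C > 0" and
    CC: "\<And>x. 0 \<le> x \<Longrightarrow> x < 1 \<Longrightarrow> summable (\<lambda>n. real (Suc n) powr a * x ^ n) \<and>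
           (\<Sum>n. real (Suc n) powr a * x ^ n) \<le> C * (1 - x) powr - (a + 1)"
    using powr_series_bound[of a] k by (auto simp: a_def)
  \<comment> \<open>The summand 1 pays for the constant coefficient, absorbed later because
    \<open>t powr - (a + 1) \<ge> 1\<close> for \<open>t \<le> 1\<close>. The factor
    \<open>4 ^ k\<close> is the square of \<open>2 ^ k\<close>, which comes from
    \<open>real (Suc (Suc n)) \<le> 2 * real (Suc n)\<close>.\<close>
  define C' where "C' = sqrt (1 + 4 ^ k * C)"
  show ?thesis
  proof (intro exI[of _ C'] conjI allI impI)
    show "C' > 0" using C by (simp add: C'_def add_pos_pos)
    fix c :: complex assume c: "cmod c < 1"
    let ?f = "\<lambda>u. inverse (1 - c * u) ^ Suc k"
    define t where "t = 1 - (cmod c)\<^sup>2"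
    have x: "0 \<le> (cmod c)\<^sup>2" "(cmod c)\<^sup>2 < 1" using c by (auto simp: abs_square_less_1)
    then have t: "0 < t" "t \<le> 1" by (auto simp: t_def)
    have hol: "?f holomorphic_on \<D>"
      using one_minus_mult_nonzero[OF c] by (auto intro!: holomorphic_intros)
    have tc: "cmod (taylor_coeff ?f n) = pochhammer (real (Suc k)) n / fact n * cmod c ^ n" for n
    proof -
      have "taylor_coeff ?f n = of_real (pochhammer (real (Suc k)) n / fact n) * c ^ n"
        using higher_deriv_inverse_power[OF c, of 0 n "Suc k"]
        by (simp add: taylor_coeff_def pochhammer_of_real[symmetric] del: of_nat_Suc)
      then show ?thesis
        by (simp add: norm_mult norm_power pochhammer_nonneg norm_divide del: of_nat_Suc)
    qed
    define V where "V n = real (Suc n) powr a * ((cmod c)\<^sup>2) ^ n" for n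
    have V: "summable V" and V': "(\<Sum>n. V n) \<le> C * t powr - (a + 1)"
      using CC[OF x] by (auto simp: V_def[abs_def] t_def)
    define W where "W n = real (Suc n) powr (1 - \<gamma>) * (cmod (taylor_coeff ?f (Suc n)))\<^sup>2" for n
    have W0: "W n \<ge> 0" for n by (simp add: W_def)
    have WV: "W n \<le> 4 ^ k * V n" for n
    proof -
      \<comment> \<open>One factor \<open>cmod c\<close> is given away to match the powers in the
        series \<open>V\<close>.\<close>
      have "cmod (taylor_coeff ?f (Suc n)) \<le> real (Suc (Suc n)) ^ k * cmod c ^ n"
        unfolding tc using c by (intro mult_mono pochhammer_fact_le power_decreasing) auto
      also have "\<dots> \<le> (2 * real (Suc n)) ^ k * cmod c ^ n"
        by (intro mult_right_mono power_mono) auto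
      finally have "(cmod (taylor_coeff ?f (Suc n)))\<^sup>2 \<le> ((2 * real (Suc n)) ^ k * cmod c ^ n)\<^sup>2"
        by (intro power_mono) auto
      also have "\<dots> = 4 ^ k * real (Suc n) powr (2 * real k) * ((cmod c)\<^sup>2) ^ n"
      proof -
        have "real (Suc n) powr (2 * real k) = (real (Suc n) ^ k)\<^sup>2"
          using powr_realpow[of "real (Suc n)" "2 * k"] by (simp add: power_even_eq del: of_nat_Suc)
        moreover have "(2 ^ k)\<^sup>2 = (4 :: real) ^ k"
          by (simp add: power2_eq_square flip: power_mult_distrib)
        moreover have "(cmod c ^ n)\<^sup>2 = ((cmod c)\<^sup>2) ^ n"
          by (simp add: power2_eq_square power_mult_distrib)
        ultimately show ?thesis by (simp add: power_mult_distrib del: of_nat_Suc)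
      qed
      finally have "W n \<le> real (Suc n) powr (1 - \<gamma>) *
          (4 ^ k * real (Suc n) powr (2 * real k) * ((cmod c)\<^sup>2) ^ n)"
        unfolding W_def by (intro mult_left_mono) auto
      also have "\<dots> = 4 ^ k * (real (Suc n) powr ((1 - \<gamma>) + 2 * real k) * ((cmod c)\<^sup>2) ^ n)"
        by (simp only: powr_add mult_ac)
      also have "(1 - \<gamma>) + 2 * real k = a" by (simp add: a_def)
      finally show ?thesis by (simp add: V_def)
    qed
    have W: "summable W"
      using WV W0 by (intro summable_comparison_test'[OF summable_mult[OF V, of "4 ^ k"], of 0]) auto
    then show "?f \<in> dirichlet_space \<gamma>"
      using hol unfolding W_def[abs_def] dirichlet_space_def by blast
    have "(\<Sum>n. W n) \<le> (\<Sum>n. 4 ^ k * V n)"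
      by (intro suminf_le WV W summable_mult V)
    also have "\<dots> \<le> 4 ^ k * (C * t powr - (a + 1))"
      using V' by (simp add: suminf_mult[OF V])
    finally have sW: "(\<Sum>n. W n) \<le> 4 ^ k * C * t powr - (a + 1)" by simp
    have "a + 1 \<ge> 0" using k by (simp add: a_def)
    then have "1 \<le> t powr - (a + 1)"
      using t powr_le1[of "a + 1" t] unfolding powr_minus by (intro one_le_inverse) auto
    then have "1 + (\<Sum>n. W n) \<le> (1 + 4 ^ k * C) * t powr - (a + 1)"
      using sW by (simp add: algebra_simps)
    then have "dirichlet_norm \<gamma> ?f \<le> sqrt ((1 + 4 ^ k * C) * t powr - (a + 1))"
      using tc[of 0] unfolding dirichlet_norm_def W_def by (intro real_sqrt_le_mono) simp
    also have "\<dots> = C' * t powr (- (a + 1) / 2)"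
      using t by (simp add: C'_def real_sqrt_mult powr_half_sqrt[symmetric] powr_powr)
    also have "- (a + 1) / 2 = - (real k + 1 - \<gamma> / 2)"
      by (simp add: a_def field_simps)
    finally show "dirichlet_norm \<gamma> ?f \<le> C' * (1 - (cmod c)\<^sup>2) powr - (real k + 1 - \<gamma> / 2)"
      by (simp add: t_def)
  qed
qed

section \<open>Testing the compact difference on kernel powers\<close>

text \<open>Differentiating the image of a test function centred at \<open>\<phi> (z n)\<close>
  gives, up to the factor \<open>of_nat (Suc k) * cnj (w n)\<close>, the displayed difference times
  \<open>t n powr - ((\<gamma> + 2) / 2)\<close>. The assumption with \<open>K\<close> makes this
  power at least a multiple of the inverse evaluation weight, so smallness at the evaluation scale
  becomes smallness of the difference.\<close>

lemma compact_difference_test: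
  fixes \<gamma> :: real
  assumes \<gamma>: "\<gamma> \<ge> - 1" and k: "2 * real k + 1 - \<gamma> \<ge> 0"
    and self: "analytic_self_map \<phi>" "analytic_self_map \<psi>"
    and T: "compact_operator_on \<gamma> (comp_op_diff \<phi> \<psi>)"
    and z: "\<And>n. z n \<in> \<D>" "(\<lambda>n. cmod (z n)) \<longlonglongrightarrow> 1"
    and K: "K > 0" "\<forall>\<^sub>F n in sequentially. 1 - (cmod (\<phi> (z n)))\<^sup>2 \<le> K * (1 - (cmod (z n))\<^sup>2)"
  shows "(\<lambda>n. deriv \<phi> (z n) - deriv \<psi> (z n) *
    ((1 - (cmod (\<phi> (z n)))\<^sup>2) / (1 - cnj (\<phi> (z n)) * \<psi> (z n))) ^ (k + 2)) \<longlonglongrightarrow> 0"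
proof -
  define w where "w n = \<phi> (z n)" for n
  define t where "t n = 1 - (cmod (w n))\<^sup>2" for n
  have hol: "\<phi> holomorphic_on \<D>" "\<psi> holomorphic_on \<D>"
    and maps: "\<And>u. u \<in> \<D> \<Longrightarrow> \<phi> u \<in> \<D>" "\<And>u. u \<in> \<D> \<Longrightarrow> \<psi> u \<in> \<D>"
    using self by (auto simp: analytic_self_map_def image_subset_iff)
  have w: "cmod (w n) < 1" for n using maps(1)[OF z(1)] by (simp add: w_def)
  have t: "t n > 0" for n using w[of n] by (simp add: t_def abs_square_less_1)
  \<comment> \<open>\<open>N n\<close> compensates the bound of
    \<open>dirichlet_norm_inverse_power\<close>, so that all \<open>s n\<close> have norm at most
    the constant \<open>C\<close>.\<close>
  define N where "N n = t n powr (real k + 1 - \<gamma> / 2)" for n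
  define s where "s n u = of_real (N n) * inverse (1 - cnj (w n) * u) ^ Suc k" for n u
  obtain C where C: "C > 0" and
    CC: "\<And>c. cmod c < 1 \<Longrightarrow> (\<lambda>u. inverse (1 - c * u) ^ Suc k) \<in> dirichlet_space \<gamma> \<and>
     dirichlet_norm \<gamma> (\<lambda>u. inverse (1 - c * u) ^ Suc k) \<le>
       C * (1 - (cmod c)\<^sup>2) powr - (real k + 1 - \<gamma> / 2)"
    using dirichlet_norm_inverse_power[OF k] by blast
  have s: "s n \<in> dirichlet_space \<gamma>" "dirichlet_norm \<gamma> (s n) \<le> C" for n
  proof -
    have c: "cmod (cnj (w n)) < 1" using w by simp
    show "s n \<in> dirichlet_space \<gamma>"
      unfolding s_def[abs_def] using CC[OF c] by (intro dirichlet_scale) auto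
    have "dirichlet_norm \<gamma> (s n) \<le> N n * (C * t n powr - (real k + 1 - \<gamma> / 2))"
      unfolding s_def[abs_def] using CC[OF c]
      by (subst dirichlet_scale) (auto simp: N_def t_def intro!: mult_left_mono)
    also have "\<dots> = C * (t n powr (real k + 1 - \<gamma> / 2) * t n powr - (real k + 1 - \<gamma> / 2))"
      by (simp add: N_def)
    also have "t n powr (real k + 1 - \<gamma> / 2) * t n powr - (real k + 1 - \<gamma> / 2) = 1"
      using t[of n] by (simp only: powr_minus) simp
    finally show "dirichlet_norm \<gamma> (s n) \<le> C" by simp
  qed
  define X where "X n = (1 - (cmod (z n))\<^sup>2) powr ((\<gamma> + 2) / 2) *
      cmod (deriv (comp_op_diff \<phi> \<psi> (s n)) (z n))" for n
  have X: "X \<longlonglongrightarrow> 0"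
    unfolding X_def[abs_def] by (rule compact_operator_deriv_vanishes[OF \<gamma> T s z])
  define D where "D n = deriv \<phi> (z n) - deriv \<psi> (z n) *
      (of_real (t n) / (1 - cnj (w n) * \<psi> (z n))) ^ (k + 2)" for n
  have deriv_eq: "cmod (deriv (comp_op_diff \<phi> \<psi> (s n)) (z n)) =
      t n powr - ((\<gamma> + 2) / 2) * (real (Suc k) * cmod (w n) * cmod (D n))" for n
  proof -
    define P where "P = inverse (1 - cnj (w n) * \<psi> (z n))"
    have d: "(\<phi> has_field_derivative deriv \<phi> (z n)) (at (z n))"
      "(\<psi> has_field_derivative deriv \<psi> (z n)) (at (z n))"
      using hol z by (auto intro!: holomorphic_derivI[of _ \<D>])
    have c: "cmod (cnj (w n)) < 1" using w by simp
    have sd: "(s n has_field_derivative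
        of_real (N n) * (of_nat (Suc k) * cnj (w n) * inverse (1 - cnj (w n) * u) ^ Suc (Suc k))) (at u)"
      if "u \<in> \<D>" for u
      unfolding s_def[abs_def] using that by (intro DERIV_cmult deriv_inverse_power c) auto
    \<comment> \<open>The kernel is evaluated at its own centre \<open>\<phi> (z n) = w n\<close>,
      so the term with \<open>deriv \<phi>\<close> carries an exact power of \<open>1 / t n\<close>;
      the term with \<open>deriv \<psi>\<close> carries the same power of \<open>P\<close>.\<close>
    have "1 - cnj (w n) * w n = of_real (t n)"
      by (simp add: t_def complex_norm_square mult.commute flip: of_real_power)
    then have invt: "inverse (1 - cnj (w n) * \<phi> (z n)) = of_real (1 / t n)"
      by (simp add: w_def inverse_eq_divide)
    have "(comp_op_diff \<phi> \<psi> (s n) has_field_derivative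
        of_real (N n) * (of_nat (Suc k) * cnj (w n) * inverse (1 - cnj (w n) * \<phi> (z n)) ^ Suc (Suc k)) * deriv \<phi> (z n) -
        of_real (N n) * (of_nat (Suc k) * cnj (w n) * P ^ Suc (Suc k)) * deriv \<psi> (z n)) (at (z n))"
      unfolding comp_op_diff_def comp_op_def o_def P_def
      using maps[OF z(1)] by (intro DERIV_diff DERIV_chain2[OF sd] d) auto
    then have "deriv (comp_op_diff \<phi> \<psi> (s n)) (z n) =
        of_real (N n) * of_nat (Suc k) * cnj (w n) *
        (of_real (1 / t n) ^ (k + 2) * deriv \<phi> (z n) - P ^ (k + 2) * deriv \<psi> (z n))"
      unfolding invt by (simp add: DERIV_imp_deriv algebra_simps)
    also have "of_real (1 / t n) ^ (k + 2) * deriv \<phi> (z n) - P ^ (k + 2) * deriv \<psi> (z n) =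
        of_real (1 / t n ^ (k + 2)) * D n"
    proof -
      have P: "P ^ (k + 2) = of_real (1 / t n ^ (k + 2)) * (of_real (t n) * P) ^ (k + 2)"
        using t[of n] by (simp add: power_mult_distrib del: power_Suc)
      have D: "D n = deriv \<phi> (z n) - deriv \<psi> (z n) * (of_real (t n) * P) ^ (k + 2)"
        by (simp only: D_def P_def divide_inverse)
      have "of_real (1 / t n) ^ (k + 2) = (of_real (1 / t n ^ (k + 2)) :: complex)"
        by (simp only: power_one_over flip: of_real_power)
      then show ?thesis
        unfolding D by (subst P) (simp only: right_diff_distrib mult_ac)
    qed
    finally have "cmod (deriv (comp_op_diff \<phi> \<psi> (s n)) (z n)) =
        (N n / t n ^ (k + 2)) * (real (Suc k) * cmod (w n) * cmod (D n))"
      using t[of n] by (simp add: norm_mult norm_divide norm_power N_def del: of_nat_Suc power_Suc)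
    \<comment> \<open>The exponent \<open>k\<close> cancels, so every kernel power reaches the same
      evaluation scale.\<close>
    also have "N n / t n ^ (k + 2) = t n powr - ((\<gamma> + 2) / 2)"
    proof -
      have "N n / t n ^ (k + 2) = t n powr (real k + 1 - \<gamma> / 2) / t n powr real (k + 2)"
        using t[of n] by (simp only: N_def powr_realpow)
      also have "\<dots> = t n powr ((real k + 1 - \<gamma> / 2) - real (k + 2))"
        by (simp only: powr_diff)
      also have "(real k + 1 - \<gamma> / 2) - real (k + 2) = - ((\<gamma> + 2) / 2)"
        by (simp add: field_simps)
      finally show ?thesis .
    qed
    finally show ?thesis .
  qed
  have zt: "1 - (cmod (z n))\<^sup>2 > 0" for n using z(1)[of n] by (simp add: abs_square_less_1)
  have bound: "\<forall>\<^sub>F n in sequentially. cmod (w n) * cmod (D n) \<le> K powr ((\<gamma> + 2) / 2) * X n"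
    using K(2)
  proof eventually_elim
    case (elim n)
    define e where "e = (\<gamma> + 2) / 2"
    have e: "e \<ge> 0" using \<gamma> by (simp add: e_def)
    have "t n powr e \<le> (K * (1 - (cmod (z n))\<^sup>2)) powr e"
      using elim t[of n] e by (intro powr_mono2) (auto simp: t_def w_def)
    also have "\<dots> = K powr e * (1 - (cmod (z n))\<^sup>2) powr e"
      using K zt[of n] by (simp add: powr_mult)
    finally have *: "1 \<le> K powr e * (1 - (cmod (z n))\<^sup>2) powr e * t n powr - e"
      using t[of n] by (simp add: powr_minus field_simps)
    have "cmod (w n) * cmod (D n) \<le> real (Suc k) * cmod (w n) * cmod (D n)"
      by (simp add: mult_right_mono mult_le_cancel_right1)
    also have "\<dots> \<le> (K powr e * (1 - (cmod (z n))\<^sup>2) powr e * t n powr - e) *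
        (real (Suc k) * cmod (w n) * cmod (D n))"
      using mult_right_mono[OF *, of "real (Suc k) * cmod (w n) * cmod (D n)"] by simp
    also have "\<dots> = K powr e * X n"
      by (simp add: X_def deriv_eq e_def mult_ac)
    finally show ?case by (simp add: e_def)
  qed
  \<comment> \<open>Eventually \<open>(cmod (w n))\<^sup>2 \<ge> 1 - K * (1 - (cmod (z
    n))\<^sup>2)\<close>, and the right side tends to 1. This keeps \<open>cmod (w n)\<close> away
    from 0, so that it can be divided out of \<open>bound\<close>.\<close>
  have "(\<lambda>n. 1 - K * (1 - (cmod (z n))\<^sup>2)) \<longlonglongrightarrow> 1 - K * (1 - 1\<^sup>2)"
    by (intro tendsto_intros z)
  then have "\<forall>\<^sub>F n in sequentially. 1 - K * (1 - (cmod (z n))\<^sup>2) > 1 / 4"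
    by (intro order_tendstoD(1)) auto
  then have half: "\<forall>\<^sub>F n in sequentially. cmod (w n) \<ge> 1 / 2"
    using K(2)
  proof eventually_elim
    case (elim n)
    then have "(1 / 2)\<^sup>2 \<le> (cmod (w n))\<^sup>2" by (simp add: w_def power2_eq_square)
    then show ?case by (rule power2_le_imp_le) simp
  qed
  have "D \<longlonglongrightarrow> 0"
  proof (rule Lim_null_comparison)
    show "\<forall>\<^sub>F n in sequentially. norm (D n) \<le> 2 * (K powr ((\<gamma> + 2) / 2) * X n)"
      using bound half
    proof eventually_elim
      case (elim n)
      have "(1 / 2) * cmod (D n) \<le> cmod (w n) * cmod (D n)"
        using elim by (intro mult_right_mono) auto
      with elim show ?case by simp
    qed
    show "(\<lambda>n. 2 * (K powr ((\<gamma> + 2) / 2) * X n)) \<longlonglongrightarrow> 0"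
      using tendsto_mult[OF tendsto_const tendsto_mult[OF tendsto_const X]] by fastforce
  qed
  then show ?thesis by (simp add: D_def[abs_def] t_def w_def)
qed

text \<open>Two consecutive powers of the ratio share the nonzero limit \<open>d1 / d2\<close>.
  Their quotient is the ratio itself, which therefore tends to 1, and then its powers tend to 1 as
  well, forcing \<open>d1 / d2 = 1\<close>.\<close>

lemma compact_difference_ratio:
  fixes \<gamma> :: real
  assumes \<gamma>: "\<gamma> \<ge> - 1"
    and self: "analytic_self_map \<phi>" "analytic_self_map \<psi>"
    and T: "compact_operator_on \<gamma> (comp_op_diff \<phi> \<psi>)"
    and z: "\<And>n. z n \<in> \<D>" "(\<lambda>n. cmod (z n)) \<longlonglongrightarrow> 1"
    and K: "K > 0" "\<forall>\<^sub>F n in sequentially. 1 - (cmod (\<phi> (z n)))\<^sup>2 \<le> K * (1 - (cmod (z n))\<^sup>2)"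
    and d: "(\<lambda>n. deriv \<phi> (z n)) \<longlonglongrightarrow> d1" "(\<lambda>n. deriv \<psi> (z n)) \<longlonglongrightarrow> d2" "d1 \<noteq> 0" "d2 \<noteq> 0"
  shows "(\<lambda>n. (1 - (cmod (\<phi> (z n)))\<^sup>2) / (1 - cnj (\<phi> (z n)) * \<psi> (z n))) \<longlonglongrightarrow> 1"
    and "d1 = d2"
proof -
  define q where "q n = (1 - (cmod (\<phi> (z n)))\<^sup>2) / (1 - cnj (\<phi> (z n)) * \<psi> (z n))" for n
  \<comment> \<open>Any \<open>k\<close> of size at least the absolute value of
    \<open>\<gamma>\<close> satisfies the exponent condition of
    \<open>compact_difference_test\<close>, and so does \<open>Suc k\<close>.\<close>
  define k where "k = nat \<lceil>\<bar>\<gamma>\<bar>\<rceil>"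
  have "real k \<ge> \<bar>\<gamma>\<bar>" unfolding k_def by linarith
  then have k: "2 * real k + 1 - \<gamma> \<ge> 0" "2 * real (Suc k) + 1 - \<gamma> \<ge> 0" by auto
  have pw: "(\<lambda>n. q n ^ (j + 2)) \<longlonglongrightarrow> d1 / d2" if "2 * real j + 1 - \<gamma> \<ge> 0" for j
  proof -
    have *: "(\<lambda>n. deriv \<phi> (z n) - deriv \<psi> (z n) * q n ^ (j + 2)) \<longlonglongrightarrow> 0"
      unfolding q_def using compact_difference_test[OF \<gamma> that self T z K] by simp
    from d(4) have "(\<lambda>n. (deriv \<phi> (z n) - (deriv \<phi> (z n) - deriv \<psi> (z n) * q n ^ (j + 2))) / deriv \<psi> (z n))
        \<longlonglongrightarrow> (d1 - 0) / d2"
      by (intro tendsto_divide[OF tendsto_diff[OF d(1) *] d(2)])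
    moreover have "\<forall>\<^sub>F n in sequentially. deriv \<psi> (z n) \<noteq> 0"
      by (rule tendsto_imp_eventually_ne[OF d(2,4)])
    then have "\<forall>\<^sub>F n in sequentially.
        (deriv \<phi> (z n) - (deriv \<phi> (z n) - deriv \<psi> (z n) * q n ^ (j + 2))) / deriv \<psi> (z n) = q n ^ (j + 2)"
      by eventually_elim simp
    ultimately show ?thesis by (simp add: tendsto_cong)
  qed
  have ne: "d1 / d2 \<noteq> 0" using d by simp
  have "(\<lambda>n. q n ^ (Suc k + 2) / q n ^ (k + 2)) \<longlonglongrightarrow> (d1 / d2) / (d1 / d2)"
    by (intro tendsto_divide pw k ne)
  moreover have "\<forall>\<^sub>F n in sequentially. q n ^ (k + 2) \<noteq> 0"
    using pw[OF k(1)] ne by (intro tendsto_imp_eventually_ne) auto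
  then have "\<forall>\<^sub>F n in sequentially. q n ^ (Suc k + 2) / q n ^ (k + 2) = q n"
    by eventually_elim simp
  ultimately have q: "q \<longlonglongrightarrow> 1" using ne by (simp add: tendsto_cong)
  then show "(\<lambda>n. (1 - (cmod (\<phi> (z n)))\<^sup>2) / (1 - cnj (\<phi> (z n)) * \<psi> (z n))) \<longlonglongrightarrow> 1"
    by (simp add: q_def[abs_def])
  have "(\<lambda>n. q n ^ (k + 2)) \<longlonglongrightarrow> 1 ^ (k + 2)" by (intro tendsto_intros q)
  then have "d1 / d2 = 1" using pw[OF k(1)] LIMSEQ_unique by fastforce
  then show "d1 = d2" using d by simp
qed

subsection \<open>Boundary expansions\<close>

lemma radial_limit_eqI:
  assumes "has_radial_limit f \<zeta> w"
  shows "radial_limit f \<zeta> = w"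
  unfolding radial_limit_def
  using assms unfolding has_radial_limit_def
  by (intro the_equality) (auto intro: tendsto_unique[OF trivial_limit_at_left_real])

lemma closed_segment_subset_insert_disc:
  assumes "\<zeta> \<in> \<T>" "z \<in> \<D>"
  shows "closed_segment \<zeta> z \<subseteq> insert \<zeta> \<D>"
proof -
  have "open_segment z \<zeta> \<subseteq> interior \<D>"
    using assms by (intro in_interior_closure_convex_segment) auto
  then show ?thesis using assms by (auto simp: closed_segment_eq_open open_segment_commute)
qed

text \<open>The remainder \<open>R\<close> has derivative
  \<open>\<phi>1 y - d - b * (y - \<zeta>)\<close>, which is of smaller order than
  \<open>y - \<zeta>\<close> because \<open>\<phi>1\<close> is differentiable at
  \<open>\<zeta>\<close>. The mean value inequality on the segment from \<open>\<zeta>\<close> to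
  \<open>z\<close> gains one more power.\<close>

lemma second_derivative_expansion:
  assumes sd: "has_second_derivative_at \<phi> \<zeta> b" and rl: "has_radial_limit \<phi> \<zeta> \<eta>" and \<zeta>: "\<zeta> \<in> \<T>"
  obtains d where "(deriv \<phi> \<longlongrightarrow> d) (at \<zeta> within \<D>)"
    "((\<lambda>z. (\<phi> z - \<eta> - d * (z - \<zeta>) - b / 2 * (z - \<zeta>)\<^sup>2) / (z - \<zeta>)\<^sup>2) \<longlongrightarrow> 0) (at \<zeta> within \<D>)"
proof -
  define S where "S = insert \<zeta> \<D>"
  \<comment> \<open>As the radial limit is \<open>\<eta>\<close>, this is the extension occurring in
    \<open>has_second_derivative_at\<close>.\<close>
  define \<Phi> where "\<Phi> = \<phi>(\<zeta> := \<eta>)"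
  obtain \<phi>1 \<phi>2 where b: "\<phi>2 \<zeta> = b" and
    d1': "\<forall>z\<in>S. (\<Phi> has_field_derivative \<phi>1 z) (at z within S)" and
    d2': "\<forall>z\<in>S. (\<phi>1 has_field_derivative \<phi>2 z) (at z within S)"
    using sd unfolding has_second_derivative_at_def radial_limit_eqI[OF rl] S_def \<Phi>_def by blast
  note d1 = d1'[rule_format] and d2 = d2'[rule_format]
  have \<zeta>S: "\<zeta> \<in> S" "\<zeta> \<notin> \<D>" using \<zeta> by (auto simp: S_def)
  define d where "d = \<phi>1 \<zeta>"
  have deriv_eq: "deriv \<phi> z = \<phi>1 z" if "z \<in> \<D>" for z
  proof -
    have "\<D> \<subseteq> interior S" unfolding S_def by (intro interior_maximal subset_insertI open_ball)
    then have "z \<in> interior S" using that by (rule subsetD)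
    then have "(\<Phi> has_field_derivative \<phi>1 z) (at z)"
      using d1[of z] interior_subset[of S] by (metis at_within_interior subsetD)
    then have "(\<phi> has_field_derivative \<phi>1 z) (at z)"
      by (rule has_field_derivative_transform_within_open[of _ _ _ \<D>])
        (use that \<zeta>S in \<open>auto simp: \<Phi>_def\<close>)
    then show ?thesis by (rule DERIV_imp_deriv)
  qed
  have "(\<phi>1 \<longlongrightarrow> d) (at \<zeta> within S)"
    using DERIV_continuous[OF d2[OF \<zeta>S(1)]] by (simp add: continuous_within d_def)
  then have "(\<phi>1 \<longlongrightarrow> d) (at \<zeta> within \<D>)"
    by (rule tendsto_within_subset) (auto simp: S_def)
  moreover have "\<forall>\<^sub>F z in at \<zeta> within \<D>. \<phi>1 z = deriv \<phi> z"
    by (auto simp: eventually_at_filter deriv_eq)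
  ultimately have lim1: "(deriv \<phi> \<longlongrightarrow> d) (at \<zeta> within \<D>)"
    by (rule Lim_transform_eventually)
  define R where "R z = \<Phi> z - \<eta> - d * (z - \<zeta>) - b / 2 * (z - \<zeta>)\<^sup>2" for z
  have "((\<lambda>z. R z / (z - \<zeta>)\<^sup>2) \<longlongrightarrow> 0) (at \<zeta> within \<D>)"
  proof (rule tendstoI)
    fix e :: real assume e: "e > 0"
    have "(\<phi>1 has_derivative (\<lambda>h. b * h)) (at \<zeta> within S)"
      using d2[OF \<zeta>S(1)] b by (simp add: has_field_derivative_def)
    then obtain \<delta> where \<delta>: "\<delta> > 0"
      "\<And>y. y \<in> S \<Longrightarrow> cmod (y - \<zeta>) < \<delta> \<Longrightarrow> cmod (\<phi>1 y - \<phi>1 \<zeta> - b * (y - \<zeta>)) \<le> e / 2 * cmod (y - \<zeta>)"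
      using e unfolding has_derivative_within_alt by (meson half_gt_zero)
    have "dist (R z / (z - \<zeta>)\<^sup>2) 0 < e" if z: "z \<in> \<D>" "z \<noteq> \<zeta>" "dist z \<zeta> < \<delta>" for z
    proof -
      \<comment> \<open>Derivatives relative to \<open>S\<close> thus restrict to the whole segment,
        its end at \<open>\<zeta>\<close> included.\<close>
      have sub: "closed_segment \<zeta> z \<subseteq> S"
        unfolding S_def using \<zeta> z by (intro closed_segment_subset_insert_disc)
      have dR: "(R has_field_derivative \<phi>1 y - d - b * (y - \<zeta>)) (at y within closed_segment \<zeta> z)"
        if "y \<in> closed_segment \<zeta> z" for y
      proof -
        have "(\<Phi> has_field_derivative \<phi>1 y) (at y within closed_segment \<zeta> z)"
          using d1[of y] sub that by (auto intro: DERIV_subset)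
        then show ?thesis unfolding R_def by (auto intro!: derivative_eq_intros)
      qed
      have bd: "cmod (\<phi>1 y - d - b * (y - \<zeta>)) \<le> e / 2 * cmod (z - \<zeta>)"
        if "y \<in> closed_segment \<zeta> z" for y
      proof -
        have le: "cmod (y - \<zeta>) \<le> cmod (z - \<zeta>)" using segment_bound1[OF that] .
        then have "cmod (\<phi>1 y - d - b * (y - \<zeta>)) \<le> e / 2 * cmod (y - \<zeta>)"
          unfolding d_def using z that sub by (intro \<delta>(2)) (auto simp: dist_norm)
        also have "\<dots> \<le> e / 2 * cmod (z - \<zeta>)" using le e by simp
        finally show ?thesis .
      qed
      have "cmod (R z - R \<zeta>) \<le> e / 2 * cmod (z - \<zeta>) * cmod (z - \<zeta>)"
        by (rule field_differentiable_bound[OF convex_closed_segment dR bd]) auto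
      then have "cmod (R z) \<le> e / 2 * (cmod (z - \<zeta>))\<^sup>2"
        by (simp add: R_def \<Phi>_def power2_eq_square)
      then have "cmod (R z / (z - \<zeta>)\<^sup>2) \<le> e / 2"
        using z by (simp add: norm_divide norm_power field_simps)
      then show ?thesis using e by simp
    qed
    then show "\<forall>\<^sub>F z in at \<zeta> within \<D>. dist (R z / (z - \<zeta>)\<^sup>2) 0 < e"
      unfolding eventually_at using \<delta>(1) by blast
  qed
  moreover have "\<forall>\<^sub>F z in at \<zeta> within \<D>.
      R z / (z - \<zeta>)\<^sup>2 = (\<phi> z - \<eta> - d * (z - \<zeta>) - b / 2 * (z - \<zeta>)\<^sup>2) / (z - \<zeta>)\<^sup>2"
    by (auto simp: eventually_at_filter R_def \<Phi>_def)
  ultimately have "((\<lambda>z. (\<phi> z - \<eta> - d * (z - \<zeta>) - b / 2 * (z - \<zeta>)\<^sup>2) / (z - \<zeta>)\<^sup>2) \<longlongrightarrow> 0) (at \<zeta> within \<D>)"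
    by (rule Lim_transform_eventually)
  with lim1 show ?thesis by (rule that)
qed

text \<open>One factor \<open>z - \<zeta>\<close> turns the expansion into a statement on the
  difference quotient, a second one into a statement on the value.\<close>

lemma second_order_expansion_quotient:
  fixes \<zeta> \<eta> b d :: complex
  assumes "((\<lambda>z. (\<phi> z - \<eta> - d * (z - \<zeta>) - b / 2 * (z - \<zeta>)\<^sup>2) / (z - \<zeta>)\<^sup>2) \<longlongrightarrow> 0) (at \<zeta> within S)"
  shows "((\<lambda>z. (\<eta> - \<phi> z) / (\<zeta> - z)) \<longlongrightarrow> d) (at \<zeta> within S)"
    and "(\<phi> \<longlongrightarrow> \<eta>) (at \<zeta> within S)"
proof -
  have id: "((\<lambda>z. z) \<longlongrightarrow> \<zeta>) (at \<zeta> within S)" by (rule tendsto_ident_at)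
  have "((\<lambda>z. (\<phi> z - \<eta> - d * (z - \<zeta>) - b / 2 * (z - \<zeta>)\<^sup>2) / (z - \<zeta>)\<^sup>2 * (z - \<zeta>) + b / 2 * (z - \<zeta>) + d)
      \<longlongrightarrow> 0 * (\<zeta> - \<zeta>) + b / 2 * (\<zeta> - \<zeta>) + d) (at \<zeta> within S)"
    by (intro tendsto_add tendsto_mult tendsto_diff assms id tendsto_const)
  moreover have "\<forall>\<^sub>F z in at \<zeta> within S.
      (\<phi> z - \<eta> - d * (z - \<zeta>) - b / 2 * (z - \<zeta>)\<^sup>2) / (z - \<zeta>)\<^sup>2 * (z - \<zeta>) + b / 2 * (z - \<zeta>) + d =
      (\<eta> - \<phi> z) / (\<zeta> - z)"
  proof -
    have "(\<phi> z - \<eta> - d * (z - \<zeta>) - b / 2 * (z - \<zeta>)\<^sup>2) / (z - \<zeta>)\<^sup>2 * (z - \<zeta>) + b / 2 * (z - \<zeta>) + d =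
      (\<eta> - \<phi> z) / (\<zeta> - z)" if "z \<noteq> \<zeta>" for z
    proof -
      define h where "h = z - \<zeta>"
      have h: "h \<noteq> 0" "\<zeta> - z = - h" using that by (auto simp: h_def)
      have A: "A / h\<^sup>2 * h = A / h" for A using h(1) by (simp add: power2_eq_square)
      show ?thesis
        unfolding h(2) h_def[symmetric] A
        using h(1) by (simp add: diff_divide_distrib power2_eq_square)
    qed
    then show ?thesis by (auto simp: eventually_at_filter)
  qed
  ultimately show *: "((\<lambda>z. (\<eta> - \<phi> z) / (\<zeta> - z)) \<longlongrightarrow> d) (at \<zeta> within S)"
    by (simp add: tendsto_cong)
  have "((\<lambda>z. \<eta> - (\<eta> - \<phi> z) / (\<zeta> - z) * (\<zeta> - z)) \<longlongrightarrow> \<eta> - d * (\<zeta> - \<zeta>)) (at \<zeta> within S)"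
    by (intro tendsto_mult tendsto_diff * id tendsto_const)
  moreover have "\<forall>\<^sub>F z in at \<zeta> within S. \<eta> - (\<eta> - \<phi> z) / (\<zeta> - z) * (\<zeta> - z) = \<phi> z"
    by (auto simp: eventually_at_filter)
  ultimately show "(\<phi> \<longlongrightarrow> \<eta>) (at \<zeta> within S)"
    by (simp add: tendsto_cong)
qed

section \<open>Schwarz-Pick, radial approach and nonzero angular derivatives\<close>

text \<open>The Schwarz lemma applies to \<open>\<phi>\<close> followed by the disc automorphism
  taking \<open>a = \<phi> 0\<close> to 0. Clearing the denominator of the automorphism gives an
  inequality between the two defects, and \<open>cmod (1 - cnj a * u) \<ge> 1 - cmod a\<close>
  yields the constant \<open>(1 - cmod a)\<^sup>2\<close>.\<close>

lemma Schwarz_Pick_lower_bound: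
  assumes "analytic_self_map \<phi>"
  shows "\<exists>c>0. \<forall>z\<in>\<D>. c * (1 - (cmod z)\<^sup>2) \<le> 1 - (cmod (\<phi> z))\<^sup>2"
proof -
  define a where "a = \<phi> 0"
  have hol: "\<phi> holomorphic_on \<D>" and maps: "\<And>z. cmod z < 1 \<Longrightarrow> cmod (\<phi> z) < 1"
    using assms by (auto simp: analytic_self_map_def image_subset_iff)
  have a: "cmod a < 1" using maps[of 0] by (simp add: a_def)
  define g where "g = Moebius_function 0 a \<circ> \<phi>"
  have holg: "g holomorphic_on \<D>"
    unfolding g_def using maps
    by (intro holomorphic_on_compose_gen[OF hol Moebius_function_holomorphic[OF a]]) auto
  have g0: "g 0 = 0" by (simp add: g_def a_def Moebius_function_eq_zero)
  have g1: "cmod (g z) < 1" if "cmod z < 1" for z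
    using that maps a by (simp add: g_def Moebius_function_norm_lt_1)
  show ?thesis
  proof (intro exI[of _ "(1 - cmod a)\<^sup>2"] conjI ballI)
    show "(1 - cmod a)\<^sup>2 > 0" using a by simp
    fix z assume "z \<in> \<D>"
    then have z: "cmod z < 1" by simp
    define u where "u = \<phi> z"
    have u: "cmod u < 1" using maps z by (simp add: u_def)
    have "cmod (cnj a * u) \<le> cmod a"
      using u by (simp add: norm_mult mult_left_le)
    then have lb: "1 - cmod a \<le> cmod (1 - cnj a * u)"
      using norm_triangle_ineq2[of 1 "cnj a * u"] by simp
    then have pos: "cmod (1 - cnj a * u) > 0" using a by linarith
    have "cmod (g z) \<le> cmod z" by (rule Schwarz_Lemma(1)[OF holg g0 g1 z])
    then have "(cmod (g z))\<^sup>2 \<le> (cmod z)\<^sup>2" by (intro power_mono) auto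
    moreover have "(cmod (g z))\<^sup>2 * (cmod (1 - cnj a * u))\<^sup>2 = (cmod (u - a))\<^sup>2"
      using pos by (simp add: g_def u_def Moebius_function_simple norm_divide power_divide)
    moreover have "(cmod (1 - cnj a * u))\<^sup>2 - (cmod (u - a))\<^sup>2 = (1 - (cmod a)\<^sup>2) * (1 - (cmod u)\<^sup>2)"
      unfolding cmod_power2 by (simp add: algebra_simps power2_eq_square)
    ultimately have "(1 - (cmod z)\<^sup>2) * (cmod (1 - cnj a * u))\<^sup>2 \<le> (1 - (cmod a)\<^sup>2) * (1 - (cmod u)\<^sup>2)"
      using mult_right_mono[of "(cmod (g z))\<^sup>2" "(cmod z)\<^sup>2" "(cmod (1 - cnj a * u))\<^sup>2"]
      by (simp add: algebra_simps)
    moreover have "(1 - (cmod z)\<^sup>2) * (1 - cmod a)\<^sup>2 \<le> (1 - (cmod z)\<^sup>2) * (cmod (1 - cnj a * u))\<^sup>2"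
      using lb a z by (intro mult_left_mono power_mono) (auto simp: abs_square_le_1)
    moreover have "(1 - (cmod a)\<^sup>2) * (1 - (cmod u)\<^sup>2) \<le> 1 - (cmod u)\<^sup>2"
      using u a by (intro mult_left_le_one_le) (auto simp: abs_square_le_1)
    ultimately show "(1 - cmod a)\<^sup>2 * (1 - (cmod z)\<^sup>2) \<le> 1 - (cmod (\<phi> z))\<^sup>2"
      by (simp add: u_def mult.commute)
  qed
qed

definition radial_seq :: "complex \<Rightarrow> nat \<Rightarrow> complex" where
  "radial_seq \<zeta> n = of_real (1 - 1 / real (n + 2)) * \<zeta>"

lemma radial_seq:
  assumes \<zeta>: "\<zeta> \<in> \<T>"
  shows "radial_seq \<zeta> n \<in> \<D>" "cmod (\<zeta> - radial_seq \<zeta> n) = 1 - cmod (radial_seq \<zeta> n)"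
    "filterlim (radial_seq \<zeta>) (at \<zeta> within \<D>) sequentially"
proof -
  have 1: "cmod (radial_seq \<zeta> n) = 1 - 1 / real (n + 2)" for n
    using \<zeta> unfolding radial_seq_def norm_mult norm_of_real by (simp add: field_simps)
  show D: "radial_seq \<zeta> n \<in> \<D>" for n by (simp add: 1)
  have ne: "radial_seq \<zeta> n \<noteq> \<zeta>" for n
    using D[of n] \<zeta> by fastforce
  have "\<zeta> - radial_seq \<zeta> n = of_real (1 / real (n + 2)) * \<zeta>"
    by (simp add: radial_seq_def algebra_simps)
  then show "cmod (\<zeta> - radial_seq \<zeta> n) = 1 - cmod (radial_seq \<zeta> n)"
    using \<zeta> unfolding 1 by (simp add: norm_mult norm_divide del: of_real_divide)
  have "(\<lambda>n. 1 / real (n + 2)) \<longlonglongrightarrow> 0"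
    using LIMSEQ_ignore_initial_segment[OF lim_1_over_n, of 2] by simp
  then have "(\<lambda>n. of_real (1 - 1 / real (n + 2)) * \<zeta>) \<longlonglongrightarrow> of_real (1 - 0) * \<zeta>"
    by (intro tendsto_intros)
  then have "radial_seq \<zeta> \<longlonglongrightarrow> \<zeta>" by (simp add: radial_seq_def[abs_def])
  then show "filterlim (radial_seq \<zeta>) (at \<zeta> within \<D>) sequentially"
    using D ne by (auto simp: filterlim_at intro!: always_eventually)
qed

text \<open>On the radius \<open>cmod (\<zeta> - z) = 1 - cmod z\<close>, while
  \<open>cmod (\<eta> - \<phi> z) \<ge> 1 - cmod (\<phi> z)\<close> is at least \<open>c / 2\<close>
  times that quantity by Schwarz-Pick. The quotient therefore stays away from 0.\<close>

lemma angular_derivative_nonzero: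
  assumes self: "analytic_self_map \<phi>" and \<zeta>: "\<zeta> \<in> \<T>" and \<eta>: "\<eta> \<in> \<T>"
    and d: "((\<lambda>z. (\<eta> - \<phi> z) / (\<zeta> - z)) \<longlongrightarrow> d) (at \<zeta> within \<D>)"
  shows "d \<noteq> 0"
proof
  assume "d = 0"
  obtain c where c: "c > 0" "\<And>z. z \<in> \<D> \<Longrightarrow> c * (1 - (cmod z)\<^sup>2) \<le> 1 - (cmod (\<phi> z))\<^sup>2"
    using Schwarz_Pick_lower_bound[OF self] by blast
  let ?z = "radial_seq \<zeta>"
  have "(\<lambda>n. cmod ((\<eta> - \<phi> (?z n)) / (\<zeta> - ?z n))) \<longlonglongrightarrow> cmod 0"
    using filterlim_compose[OF d radial_seq(3)[OF \<zeta>]] \<open>d = 0\<close> by (intro tendsto_norm) simp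
  moreover have "c / 2 \<le> cmod ((\<eta> - \<phi> (?z n)) / (\<zeta> - ?z n))" for n
  proof -
    define r where "r = cmod (?z n)"
    define p where "p = cmod (\<phi> (?z n))"
    have r: "0 \<le> r" "r < 1" using radial_seq(1)[OF \<zeta>, of n] by (auto simp: r_def)
    have p: "0 \<le> p" "p < 1" using radial_seq(1)[OF \<zeta>, of n] self
      by (auto simp: p_def analytic_self_map_def image_subset_iff)
    have "c * (1 - r) \<le> c * (1 - r\<^sup>2)"
      using c r by (intro mult_left_mono) (auto simp: power2_eq_square mult_left_le)
    also have "\<dots> \<le> 1 - p\<^sup>2" using c(2)[OF radial_seq(1)[OF \<zeta>]] by (simp add: r_def p_def)
    also have "\<dots> = (1 - p) * (1 + p)" by (simp add: power2_eq_square algebra_simps)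
    also have "\<dots> \<le> (1 - p) * 2" using p by (intro mult_left_mono) auto
    also have "1 - p \<le> cmod (\<eta> - \<phi> (?z n))"
      using norm_triangle_ineq2[of \<eta> "\<phi> (?z n)"] \<eta> by (simp add: p_def)
    finally have "c / 2 * (1 - r) \<le> cmod (\<eta> - \<phi> (?z n))" by simp
    then show ?thesis
      using r by (simp add: norm_divide radial_seq(2)[OF \<zeta>] r_def field_simps)
  qed
  ultimately have "c / 2 \<le> cmod 0"
    by (intro LIMSEQ_le_const) auto
  with c show False by simp
qed

text \<open>
  An oricyclic approach to \<open>\<zeta>\<close>: here \<open>1 - cmod z\<close> is comparable to the square of the distance from
  \<open>\<zeta>\<close>, so that second order terms are visible at the scale of \<open>1 - cmod z\<close>.
\<close>

definition oricycle :: "complex \<Rightarrow> real \<Rightarrow> complex" where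
  "oricycle \<zeta> y = \<zeta> * (1 - Complex (y\<^sup>2) y)"

lemma oricycle:
  assumes \<zeta>: "\<zeta> \<in> \<T>"
  shows "1 - (cmod (oricycle \<zeta> y))\<^sup>2 = y\<^sup>2 - y ^ 4" "(cmod (oricycle \<zeta> y - \<zeta>))\<^sup>2 = y\<^sup>2 + y ^ 4"
    "filterlim (oricycle \<zeta>) (at \<zeta> within \<D>) (at 0)"
proof -
  show 1: "1 - (cmod (oricycle \<zeta> y))\<^sup>2 = y\<^sup>2 - y ^ 4" for y
  proof -
    have "cmod (oricycle \<zeta> y) = cmod (1 - Complex (y\<^sup>2) y)"
      using \<zeta> by (simp add: oricycle_def norm_mult)
    then have "(cmod (oricycle \<zeta> y))\<^sup>2 = (1 - y\<^sup>2)\<^sup>2 + y\<^sup>2" by (simp add: cmod_power2)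
    then show ?thesis by (simp add: power2_eq_square power4_eq_xxxx algebra_simps)
  qed
  have "oricycle \<zeta> y - \<zeta> = - (\<zeta> * Complex (y\<^sup>2) y)" by (simp add: oricycle_def algebra_simps)
  then have "(cmod (oricycle \<zeta> y - \<zeta>))\<^sup>2 = (y\<^sup>2)\<^sup>2 + y\<^sup>2"
    using \<zeta> by (simp add: norm_mult cmod_power2)
  then show "(cmod (oricycle \<zeta> y - \<zeta>))\<^sup>2 = y\<^sup>2 + y ^ 4"
    by (simp add: power2_eq_square power4_eq_xxxx)
  have "((\<lambda>y. \<zeta> * (1 - (of_real (y\<^sup>2) + \<i> * of_real y))) \<longlongrightarrow> \<zeta> * (1 - (of_real (0\<^sup>2) + \<i> * of_real 0))) (at 0)"
    by (intro tendsto_intros)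
  then have "(oricycle \<zeta> \<longlongrightarrow> \<zeta>) (at 0)"
    by (simp add: oricycle_def[abs_def] Complex_eq)
  moreover have "oricycle \<zeta> y \<in> \<D> \<and> oricycle \<zeta> y \<noteq> \<zeta>" if "y \<noteq> 0" "\<bar>y\<bar> < 1" for y
  proof -
    have "y\<^sup>2 * y\<^sup>2 < y\<^sup>2 * 1" using that by (intro mult_strict_left_mono) (auto simp: abs_square_less_1)
    then have "(cmod (oricycle \<zeta> y))\<^sup>2 < 1" using 1[of y] by (simp add: power4_eq_xxxx power2_eq_square)
    then show ?thesis using \<zeta> by (auto simp: abs_square_less_1)
  qed
  then have "\<forall>\<^sub>F y in at 0. oricycle \<zeta> y \<in> \<D> \<and> oricycle \<zeta> y \<noteq> \<zeta>"
    unfolding eventually_at by (intro exI[of _ 1]) (auto simp: dist_norm)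
  ultimately show "filterlim (oricycle \<zeta>) (at \<zeta> within \<D>) (at 0)"
    by (auto simp: filterlim_at elim: eventually_mono)
qed

text \<open>
  The term \<open>y * Im \<mu>\<close> below changes sign at \<open>0\<close>, but \<open>cmod (\<phi> z) < 1\<close> bounds it by a multiple of
  \<open>y\<^sup>2\<close> on both sides; hence \<open>\<mu>\<close> is real and the defect is of second order.
\<close>

lemma oricycle_defect_bound:
  assumes self: "analytic_self_map \<phi>" and \<zeta>: "\<zeta> \<in> \<T>" and \<eta>: "\<eta> \<in> \<T>"
    and ex: "((\<lambda>z. (\<phi> z - \<eta> - d * (z - \<zeta>) - b / 2 * (z - \<zeta>)\<^sup>2) / (z - \<zeta>)\<^sup>2) \<longlongrightarrow> 0) (at \<zeta> within \<D>)"
  shows "\<exists>K>0. \<forall>\<^sub>F y in at 0. 1 - (cmod (\<phi> (oricycle \<zeta> y)))\<^sup>2 \<le> K * (1 - (cmod (oricycle \<zeta> y))\<^sup>2)"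
proof -
  \<comment> \<open>With \<open>h = Complex (y\<^sup>2) y\<close> the point is
    \<open>z = \<zeta> * (1 - h)\<close>, and
    \<open>cnj \<eta> * \<phi> z = 1 - \<mu> * h + E\<close> with \<open>E\<close> the rotated error
    of the first order expansion. So \<open>\<mu>\<close> is the derivative after both boundary
    points are rotated to 1.\<close>
  define \<mu> where "\<mu> = d * \<zeta> * cnj \<eta>"
  \<comment> \<open>In \<open>B\<close>, 1 is the tolerance in the expansion and
    \<open>cmod b\<close> covers its quadratic term. In \<open>C\<close>, the modulus of
    \<open>Re \<mu>\<close> comes from the real part of \<open>\<mu> * h\<close>, and
    \<open>2 * B\<close> from \<open>(cmod (z - \<zeta>))\<^sup>2 = y\<^sup>2 + y ^ 4 \<le> 2 *
    y\<^sup>2\<close> for small \<open>y\<close>.\<close>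
  define B where "B = 1 + cmod b"
  define C where "C = \<bar>Re \<mu>\<bar> + 2 * B"
  have \<eta>\<eta>: "cnj \<eta> * \<eta> = 1" using \<eta> by (simp add: complex_norm_square[symmetric] mult.commute)
  have "\<forall>\<^sub>F z in at \<zeta> within \<D>. dist ((\<phi> z - \<eta> - d * (z - \<zeta>) - b / 2 * (z - \<zeta>)\<^sup>2) / (z - \<zeta>)\<^sup>2) 0 < 1"
    using ex by (rule tendstoD) simp
  moreover have "\<forall>\<^sub>F z in at \<zeta> within \<D>. z \<in> \<D> \<and> z \<noteq> \<zeta>" by (auto simp: eventually_at_filter)
  ultimately have "\<forall>\<^sub>F z in at \<zeta> within \<D>. z \<in> \<D> \<and> cmod (\<phi> z - \<eta> - d * (z - \<zeta>)) \<le> B * (cmod (z - \<zeta>))\<^sup>2"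
  proof eventually_elim
    case (elim z)
    then have "cmod (\<phi> z - \<eta> - d * (z - \<zeta>) - b / 2 * (z - \<zeta>)\<^sup>2) \<le> (cmod (z - \<zeta>))\<^sup>2"
      by (simp add: norm_divide norm_power field_simps)
    moreover have "cmod (b / 2 * (z - \<zeta>)\<^sup>2) \<le> cmod b * (cmod (z - \<zeta>))\<^sup>2"
      by (simp add: norm_mult norm_divide norm_power mult_right_mono)
    ultimately have "cmod (\<phi> z - \<eta> - d * (z - \<zeta>)) \<le> B * (cmod (z - \<zeta>))\<^sup>2"
      using norm_triangle_ineq[of "\<phi> z - \<eta> - d * (z - \<zeta>) - b / 2 * (z - \<zeta>)\<^sup>2" "b / 2 * (z - \<zeta>)\<^sup>2"]
      by (simp add: B_def algebra_simps)
    with elim show ?case by simp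
  qed
  from eventually_compose_filterlim[OF this oricycle(3)[OF \<zeta>]]
  have ev: "\<forall>\<^sub>F y in at 0. oricycle \<zeta> y \<in> \<D> \<and>
      cmod (\<phi> (oricycle \<zeta> y) - \<eta> - d * (oricycle \<zeta> y - \<zeta>)) \<le> B * (cmod (oricycle \<zeta> y - \<zeta>))\<^sup>2" .
  have small: "\<forall>\<^sub>F y in at 0. \<bar>y :: real\<bar> < 1 / 2"
    unfolding eventually_at by (intro exI[of _ "1 / 2"]) (auto simp: dist_norm)
  have key: "\<forall>\<^sub>F y in at 0. cmod (\<phi> (oricycle \<zeta> y)) < 1 \<and>
      1 - Re (cnj \<eta> * \<phi> (oricycle \<zeta> y)) \<le> C * y\<^sup>2 - Im \<mu> * y"
    using ev small
  proof eventually_elim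
    case (elim y)
    define E where "E = cnj \<eta> * (\<phi> (oricycle \<zeta> y) - \<eta> - d * (oricycle \<zeta> y - \<zeta>))"
    have y4: "y ^ 4 \<le> y\<^sup>2"
      using elim power_decreasing[of 2 4 "\<bar>y\<bar>"] by simp
    have B: "B \<ge> 0" by (simp add: B_def)
    have "cmod E \<le> B * (y\<^sup>2 + y ^ 4)"
      using elim \<eta> by (simp add: E_def norm_mult oricycle(2)[OF \<zeta>])
    also have "\<dots> \<le> B * (2 * y\<^sup>2)" using y4 B by (intro mult_left_mono) auto
    finally have E: "\<bar>Re E\<bar> \<le> 2 * B * y\<^sup>2"
      using abs_Re_le_cmod[of E] by simp
    have diff: "oricycle \<zeta> y - \<zeta> = - (\<zeta> * Complex (y\<^sup>2) y)"
      by (simp add: oricycle_def algebra_simps)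
    have "cnj \<eta> * \<phi> (oricycle \<zeta> y) = 1 - \<mu> * Complex (y\<^sup>2) y + E"
      using \<eta>\<eta> unfolding E_def \<mu>_def diff by (simp add: algebra_simps)
    then have "1 - Re (cnj \<eta> * \<phi> (oricycle \<zeta> y)) = Re \<mu> * y\<^sup>2 - Im \<mu> * y - Re E"
      by simp
    also have "\<dots> \<le> C * y\<^sup>2 - Im \<mu> * y"
      using E mult_right_mono[OF abs_ge_self[of "Re \<mu>"], of "y\<^sup>2"] by (simp add: C_def algebra_simps)
    finally show ?case using elim self by (auto simp: analytic_self_map_def image_subset_iff)
  qed
  have Re_lt: "Re (cnj \<eta> * u) \<le> cmod u" for u
    using complex_Re_le_cmod[of "cnj \<eta> * u"] \<eta> by (simp add: norm_mult)
  \<comment> \<open>Since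
    \<open>1 - Re (cnj \<eta> * \<phi> z) \<ge> 1 - cmod (\<phi> z) > 0\<close>, the upper bound in
    \<open>key\<close> is positive.\<close>
  have sgn: "\<forall>\<^sub>F y in at 0. Im \<mu> * y \<le> C * y * y"
    using key
  proof eventually_elim
    case (elim y)
    then show ?case using Re_lt[of "\<phi> (oricycle \<zeta> y)"] by (simp add: power2_eq_square)
  qed
  have sgn': "\<forall>\<^sub>F y in at 0 within S. Im \<mu> * y \<le> C * y * y" for S
    using filter_leD[OF at_le[OF subset_UNIV] sgn] .
  have "Im \<mu> = 0"
  proof (rule antisym)
    have lim: "((\<lambda>y. C * y) \<longlongrightarrow> C * 0) (at 0 within S)" for S
      by (intro tendsto_intros)
    have "\<forall>\<^sub>F y in at_right 0. Im \<mu> \<le> C * y"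
      using sgn' eventually_at_right_less[of 0] by eventually_elim simp
    then show "Im \<mu> \<le> 0" using tendsto_lowerbound[OF lim] by fastforce
    have "\<forall>\<^sub>F y in at_left 0. y < (0 :: real)" by (simp add: eventually_at_filter)
    with sgn' have "\<forall>\<^sub>F y in at_left 0. C * y \<le> Im \<mu>"
      by eventually_elim simp
    then show "0 \<le> Im \<mu>" using tendsto_upperbound[OF lim] by fastforce
  qed
  show ?thesis
  \<comment> \<open>One factor 2 comes from \<open>1 + p \<le> 2\<close>, the other from
    \<open>y\<^sup>2 \<le> 2 * (y\<^sup>2 - y ^ 4)\<close>, valid when the modulus of
    \<open>y\<close> is below \<open>1 / 2\<close>.\<close>
  proof (intro exI[of _ "4 * C"] conjI)
    show "4 * C > 0" by (simp add: C_def B_def add_nonneg_pos add_pos_nonneg)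
    then have C: "C > 0" by simp
    show "\<forall>\<^sub>F y in at 0. 1 - (cmod (\<phi> (oricycle \<zeta> y)))\<^sup>2 \<le> 4 * C * (1 - (cmod (oricycle \<zeta> y))\<^sup>2)"
      using key small
    proof eventually_elim
      case (elim y)
      define p where "p = cmod (\<phi> (oricycle \<zeta> y))"
      have p: "0 \<le> p" "p < 1" "1 - p \<le> C * y\<^sup>2"
        using elim \<open>Im \<mu> = 0\<close> Re_lt[of "\<phi> (oricycle \<zeta> y)"] by (auto simp: p_def)
      have "1 - p\<^sup>2 = (1 - p) * (1 + p)" by (simp add: power2_eq_square algebra_simps)
      also have "\<dots> \<le> (1 - p) * 2" using p by (intro mult_left_mono) auto
      also have "\<dots> \<le> C * (2 * y\<^sup>2)" using p by simp
      also have "2 * y\<^sup>2 \<le> 4 * (y\<^sup>2 - y ^ 4)"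
      proof -
        have "y\<^sup>2 \<le> (1 / 2)\<^sup>2" using elim by (intro abs_le_square_iff[THEN iffD1]) simp
        then have "y\<^sup>2 * y\<^sup>2 \<le> y\<^sup>2 * (1 / 2)" by (intro mult_left_mono) (auto simp: power2_eq_square)
        then show ?thesis by (simp add: power4_eq_xxxx power2_eq_square)
      qed
      then have "C * (2 * y\<^sup>2) \<le> C * (4 * (y\<^sup>2 - y ^ 4))" using C by (intro mult_left_mono) auto
      finally show ?case by (simp add: p_def oricycle(1)[OF \<zeta>] algebra_simps)
    qed
  qed
qed

subsection \<open>Equality of the boundary data\<close>

text \<open>The radial sequence is treated first: once values and first derivatives agree, the
  expansions give \<open>(\<phi> z - \<psi> z) / (z - \<zeta>)\<^sup>2\<close> the limit
  \<open>(b1 - b2) / 2\<close>. The oricyclic sequence then shows that this limit is 0.\<close>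

lemma compact_difference_same_second_order_data:
  fixes \<gamma> :: real
  assumes \<gamma>: "\<gamma> \<ge> - 1"
    and self: "analytic_self_map \<phi>" "analytic_self_map \<psi>"
    and T: "compact_operator_on \<gamma> (comp_op_diff \<phi> \<psi>)"
    and \<zeta>: "\<zeta> \<in> unimodular_set \<phi>" "\<zeta> \<in> unimodular_set \<psi>"
    and sd: "second_order_data \<phi> \<zeta>" "second_order_data \<psi> \<zeta>"
  shows "same_second_order_data \<phi> \<psi> \<zeta>"
proof -
  have \<zeta>T: "\<zeta> \<in> \<T>" using \<zeta> by (simp add: unimodular_set_def)
  obtain \<eta>1 \<eta>2 where rl: "has_radial_limit \<phi> \<zeta> \<eta>1" "has_radial_limit \<psi> \<zeta> \<eta>2"
    and \<eta>T: "\<eta>1 \<in> \<T>" "\<eta>2 \<in> \<T>"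
    using \<zeta> by (auto simp: unimodular_set_def)
  obtain b1 b2 where b1: "has_second_derivative_at \<phi> \<zeta> b1" and b2: "has_second_derivative_at \<psi> \<zeta> b2"
    using sd by (auto simp: second_order_data_def)
  obtain d1 where dlim1: "(deriv \<phi> \<longlongrightarrow> d1) (at \<zeta> within \<D>)"
    and ex1: "((\<lambda>z. (\<phi> z - \<eta>1 - d1 * (z - \<zeta>) - b1 / 2 * (z - \<zeta>)\<^sup>2) / (z - \<zeta>)\<^sup>2) \<longlongrightarrow> 0) (at \<zeta> within \<D>)"
    using second_derivative_expansion[OF b1 rl(1) \<zeta>T] .
  obtain d2 where dlim2: "(deriv \<psi> \<longlongrightarrow> d2) (at \<zeta> within \<D>)"
    and ex2: "((\<lambda>z. (\<psi> z - \<eta>2 - d2 * (z - \<zeta>) - b2 / 2 * (z - \<zeta>)\<^sup>2) / (z - \<zeta>)\<^sup>2) \<longlongrightarrow> 0) (at \<zeta> within \<D>)"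
    using second_derivative_expansion[OF b2 rl(2) \<zeta>T] .
  note quot1 = second_order_expansion_quotient[OF ex1]
  note quot2 = second_order_expansion_quotient[OF ex2]
  have nz: "d1 \<noteq> 0" "d2 \<noteq> 0"
    using angular_derivative_nonzero[OF self(1) \<zeta>T \<eta>T(1) quot1(1)]
      angular_derivative_nonzero[OF self(2) \<zeta>T \<eta>T(2) quot2(1)] .
  have maps: "cmod (\<phi> u) < 1" "cmod (\<psi> u) < 1" if "u \<in> \<D>" for u
    using self that by (auto simp: analytic_self_map_def image_subset_iff)
  have norm_lim: "(\<lambda>n. cmod (z n)) \<longlonglongrightarrow> 1" if "filterlim z (at \<zeta> within \<D>) sequentially" for z :: "nat \<Rightarrow> complex"
    using tendsto_norm[OF filterlim_compose[OF tendsto_ident_at that]] \<zeta>T by simp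
  have defect_pos: "1 - (cmod (\<phi> u))\<^sup>2 > 0" if "u \<in> \<D>" for u
    using maps[OF that] by (simp add: abs_square_less_1)

  \<comment> \<open>Radial approach: values and first derivatives\<close>
  define z where "z = radial_seq \<zeta>"
  note zlim = radial_seq(3)[OF \<zeta>T, folded z_def]
  have zD: "z n \<in> \<D>" for n unfolding z_def by (rule radial_seq(1)[OF \<zeta>T])
  \<comment> \<open>The difference quotient is eventually below \<open>cmod d1 + 1\<close> in
    modulus, and passing from \<open>1 - p\<close> to \<open>1 - p\<^sup>2\<close> costs a factor
    2.\<close>
  define K where "K = 2 * (cmod d1 + 1)"
  have K: "K > 0" by (simp add: K_def add_nonneg_pos)
  have "(\<lambda>n. cmod ((\<eta>1 - \<phi> (z n)) / (\<zeta> - z n))) \<longlonglongrightarrow> cmod d1"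
    by (intro tendsto_norm filterlim_compose[OF quot1(1) zlim])
  then have "\<forall>\<^sub>F n in sequentially. cmod ((\<eta>1 - \<phi> (z n)) / (\<zeta> - z n)) < cmod d1 + 1"
    by (rule order_tendstoD(2)) simp
  then have Kz: "\<forall>\<^sub>F n in sequentially. 1 - (cmod (\<phi> (z n)))\<^sup>2 \<le> K * (1 - (cmod (z n))\<^sup>2)"
  proof eventually_elim
    case (elim n)
    define r where "r = cmod (z n)"
    define p where "p = cmod (\<phi> (z n))"
    have r: "0 \<le> r" "r < 1" using zD[of n] by (auto simp: r_def)
    have p: "0 \<le> p" "p < 1" using maps[OF zD[of n]] by (auto simp: p_def)
    have "cmod (\<zeta> - z n) = 1 - r" unfolding r_def z_def by (rule radial_seq(2)[OF \<zeta>T])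
    with elim have "cmod (\<eta>1 - \<phi> (z n)) / (1 - r) < cmod d1 + 1" by (simp add: norm_divide)
    then have "cmod (\<eta>1 - \<phi> (z n)) < (cmod d1 + 1) * (1 - r)"
      using r by (simp only: pos_divide_less_eq diff_gt_0_iff_gt)
    moreover have "1 - p \<le> cmod (\<eta>1 - \<phi> (z n))"
      using norm_triangle_ineq2[of \<eta>1 "\<phi> (z n)"] \<eta>T by (simp add: p_def)
    ultimately have "1 - p \<le> (cmod d1 + 1) * (1 - r)" by linarith
    then have *: "2 * (1 - p) \<le> K * (1 - r)"
      unfolding K_def mult.assoc by (rule mult_left_mono) simp
    have "1 - p\<^sup>2 = (1 + p) * (1 - p)" by (simp add: power2_eq_square algebra_simps)
    also have "\<dots> \<le> 2 * (1 - p)" using p by (intro mult_right_mono) auto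
    also note *
    also have "K * (1 - r) \<le> K * (1 - r\<^sup>2)"
      using K r by (intro mult_left_mono) (auto simp: power2_eq_square mult_left_le)
    finally show ?case by (simp add: p_def r_def)
  qed
  note radial = compact_difference_ratio[OF \<gamma> self T zD norm_lim[OF zlim] K Kz
      filterlim_compose[OF dlim1 zlim] filterlim_compose[OF dlim2 zlim] nz]
  have d: "d1 = d2" by (rule radial(2))
  \<comment> \<open>For distinct boundary values the denominator of the ratio would keep a nonzero
    limit while the numerator tends to 0, so the ratio would tend to 0 instead of 1.\<close>
  have \<eta>: "\<eta>1 = \<eta>2"
  proof (rule ccontr)
    assume ne: "\<eta>1 \<noteq> \<eta>2"
    have "1 - cnj \<eta>1 * \<eta>2 \<noteq> 0"
    proof
      assume "1 - cnj \<eta>1 * \<eta>2 = 0"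
      then have "\<eta>1 * (cnj \<eta>1 * \<eta>2) = \<eta>1" by simp
      moreover have "\<eta>1 * cnj \<eta>1 = 1" using \<eta>T by (simp add: complex_norm_square[symmetric])
      then have "\<eta>1 * (cnj \<eta>1 * \<eta>2) = \<eta>2" by (simp add: mult.assoc[symmetric])
      ultimately show False using ne by simp
    qed
    note lims = filterlim_compose[OF quot1(2) zlim] filterlim_compose[OF quot2(2) zlim]
    have "(\<lambda>n. of_real (1 - (cmod (\<phi> (z n)))\<^sup>2) / (1 - cnj (\<phi> (z n)) * \<psi> (z n)))
        \<longlonglongrightarrow> of_real (1 - (cmod \<eta>1)\<^sup>2) / (1 - cnj \<eta>1 * \<eta>2)"
      by (intro tendsto_intros lims) fact
    then have "(\<lambda>n. of_real (1 - (cmod (\<phi> (z n)))\<^sup>2) / (1 - cnj (\<phi> (z n)) * \<psi> (z n))) \<longlonglongrightarrow> 0"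
      using \<eta>T by simp
    from LIMSEQ_unique[OF this radial(1)] show False by simp
  qed

  \<comment> \<open>Oricyclic approach: second derivatives\<close>
  obtain K' where K': "K' > 0"
    and K'b: "\<forall>\<^sub>F y in at 0. 1 - (cmod (\<phi> (oricycle \<zeta> y)))\<^sup>2 \<le> K' * (1 - (cmod (oricycle \<zeta> y))\<^sup>2)"
    using oricycle_defect_bound[OF self(1) \<zeta>T \<eta>T(1) ex1] by blast
  \<comment> \<open>With \<open>n + 1\<close> in place of \<open>n + 2\<close> the first parameter
    would be 1, whose point on the oricycle lies on the unit circle and not in the disc.\<close>
  define y where "y n = 1 / real (n + 2)" for n
  define x where "x n = oricycle \<zeta> (y n)" for n
  have "y \<longlonglongrightarrow> 0"
    unfolding y_def using LIMSEQ_ignore_initial_segment[OF lim_1_over_n, of 2] by simp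
  then have ylim: "filterlim y (at 0) sequentially"
    by (simp add: filterlim_at y_def)
  then have xlim: "filterlim x (at \<zeta> within \<D>) sequentially"
    unfolding x_def by (rule filterlim_compose[OF oricycle(3)[OF \<zeta>T]])
  have xD: "x n \<in> \<D>" for n
  proof -
    have "0 < (y n)\<^sup>2" "(y n)\<^sup>2 < 1" by (auto simp: y_def power_divide abs_square_less_1)
    then have "(y n)\<^sup>2 * (y n)\<^sup>2 < (y n)\<^sup>2 * 1" by (intro mult_strict_left_mono) auto
    then have "(cmod (x n))\<^sup>2 < 1"
      using oricycle(1)[OF \<zeta>T, of "y n"] by (simp add: x_def power4_eq_xxxx power2_eq_square)
    then show ?thesis by (simp add: abs_square_less_1)
  qed
  have K'x: "\<forall>\<^sub>F n in sequentially. 1 - (cmod (\<phi> (x n)))\<^sup>2 \<le> K' * (1 - (cmod (x n))\<^sup>2)"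
    unfolding x_def by (rule eventually_compose_filterlim[OF K'b ylim])
  define q where "q n = (1 - (cmod (\<phi> (x n)))\<^sup>2) / (1 - cnj (\<phi> (x n)) * \<psi> (x n))" for n
  have "q \<longlonglongrightarrow> 1"
    unfolding q_def using compact_difference_ratio(1)[OF \<gamma> self T xD norm_lim[OF xlim] K' K'x
      filterlim_compose[OF dlim1 xlim] filterlim_compose[OF dlim2 xlim] nz] by simp
  then have inv_lim: "(\<lambda>n. cmod (inverse (q n) - 1)) \<longlonglongrightarrow> cmod (inverse 1 - 1)"
    by (intro tendsto_intros) simp_all
  have wlim: "(\<lambda>n. cmod (\<phi> (x n))) \<longlonglongrightarrow> 1"
    using tendsto_norm[OF filterlim_compose[OF quot1(2) xlim]] \<eta>T by simp
  have rhs: "(\<lambda>n. cmod (inverse (q n) - 1) * K' / cmod (\<phi> (x n))) \<longlonglongrightarrow> cmod (inverse 1 - 1) * K' / 1"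
    by (intro tendsto_divide tendsto_mult inv_lim wlim tendsto_const) simp
  \<comment> \<open>The limit of \<open>e\<close> is found twice: it is 0 by
    \<open>q \<longlonglongrightarrow> 1\<close>, and \<open>(b1 - b2) / 2\<close> by the
    expansions.\<close>
  define e where "e n = (\<phi> (x n) - \<psi> (x n)) / (x n - \<zeta>)\<^sup>2" for n
  have "\<forall>\<^sub>F n in sequentially. cmod (\<phi> (x n)) \<noteq> 0"
    by (rule tendsto_imp_eventually_ne[OF wlim]) simp
  with K'x have "\<forall>\<^sub>F n in sequentially. norm (e n) \<le> cmod (inverse (q n) - 1) * K' / cmod (\<phi> (x n))"
  proof eventually_elim
    case (elim n)
    define w where "w = \<phi> (x n)"
    define t where "t = 1 - (cmod w)\<^sup>2"
    have t: "t > 0" using defect_pos[OF xD] by (simp add: t_def w_def)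
    have ww: "cnj w * w = 1 - of_real t"
      by (simp add: t_def complex_norm_square mult.commute flip: of_real_power)
    \<comment> \<open>The inverse ratio minus 1 measures \<open>\<phi> - \<psi>\<close> relative to
      the defect \<open>t\<close>, which is at most \<open>K'\<close> times the squared distance
      \<open>s\<close> from \<open>\<zeta>\<close>.\<close>
    have "inverse (q n) - 1 = (1 - cnj w * \<psi> (x n)) / of_real t - 1"
      by (simp add: q_def w_def t_def)
    also have "\<dots> = (1 - of_real t - cnj w * \<psi> (x n)) / of_real t"
      using t by (simp add: field_simps)
    also have "\<dots> = cnj w * (w - \<psi> (x n)) / of_real t"
      by (simp add: ww[symmetric] algebra_simps)
    finally have q: "cmod (inverse (q n) - 1) = cmod w * cmod (w - \<psi> (x n)) / t"
      using t by (simp add: norm_mult norm_divide)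
    define s where "s = (cmod (x n - \<zeta>))\<^sup>2"
    have "t \<le> K' * ((y n)\<^sup>2 - y n ^ 4)"
      using elim by (simp add: t_def w_def x_def oricycle(1)[OF \<zeta>T])
    also have "\<dots> \<le> K' * s"
      using K' unfolding s_def x_def oricycle(2)[OF \<zeta>T] by (intro mult_left_mono) auto
    finally have ts: "t \<le> K' * s" .
    with t have s: "s > 0" using K' by (smt (verit) mult_nonneg_nonpos)
    have "norm (e n) = cmod (w - \<psi> (x n)) / s"
      by (simp add: e_def w_def s_def norm_divide norm_power)
    also have "\<dots> \<le> cmod (w - \<psi> (x n)) * (K' / t)"
    proof -
      have "1 / s \<le> K' / t" using ts s t by (simp add: field_simps)
      from mult_left_mono[OF this, of "cmod (w - \<psi> (x n))"] show ?thesis by simp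
    qed
    also have "\<dots> = cmod (inverse (q n) - 1) * K' / cmod w"
      using elim by (simp add: q w_def)
    finally show ?case by (simp add: w_def)
  qed
  moreover have "(\<lambda>n. cmod (inverse (q n) - 1) * K' / cmod (\<phi> (x n))) \<longlonglongrightarrow> 0"
    using rhs by simp
  ultimately have e0: "e \<longlonglongrightarrow> 0" by (rule Lim_null_comparison)
  have "((\<lambda>z. (\<phi> z - \<psi> z) / (z - \<zeta>)\<^sup>2) \<longlongrightarrow> (b1 - b2) / 2) (at \<zeta> within \<D>)"
  proof -
    have "((\<lambda>z. (\<phi> z - \<eta>1 - d1 * (z - \<zeta>) - b1 / 2 * (z - \<zeta>)\<^sup>2) / (z - \<zeta>)\<^sup>2 -
        (\<psi> z - \<eta>2 - d2 * (z - \<zeta>) - b2 / 2 * (z - \<zeta>)\<^sup>2) / (z - \<zeta>)\<^sup>2 + (b1 - b2) / 2)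
        \<longlongrightarrow> 0 - 0 + (b1 - b2) / 2) (at \<zeta> within \<D>)"
      by (intro tendsto_add tendsto_diff ex1 ex2 tendsto_const)
    moreover have "\<forall>\<^sub>F z in at \<zeta> within \<D>.
        (\<phi> z - \<eta>1 - d1 * (z - \<zeta>) - b1 / 2 * (z - \<zeta>)\<^sup>2) / (z - \<zeta>)\<^sup>2 -
        (\<psi> z - \<eta>2 - d2 * (z - \<zeta>) - b2 / 2 * (z - \<zeta>)\<^sup>2) / (z - \<zeta>)\<^sup>2 + (b1 - b2) / 2 =
        (\<phi> z - \<psi> z) / (z - \<zeta>)\<^sup>2"
    proof -
      have "(p - a - l * h - b1 / 2 * h\<^sup>2) / h\<^sup>2 - (p' - a - l * h - b2 / 2 * h\<^sup>2) / h\<^sup>2 +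
          (b1 - b2) / 2 = (p - p') / h\<^sup>2" if "h \<noteq> 0" for p p' a l h :: complex
        using that by (simp add: diff_divide_distrib)
      then show ?thesis by (simp add: eventually_at_filter d \<eta>)
    qed
    ultimately show ?thesis by (simp add: tendsto_cong)
  qed
  from filterlim_compose[OF this xlim] have "e \<longlonglongrightarrow> (b1 - b2) / 2"
    by (simp add: e_def[abs_def])
  from LIMSEQ_unique[OF e0 this] have b: "b1 = b2" by simp

  \<comment> \<open>A limit within the whole disc restricts to every nontangential region, and
    \<open>\<eta>1\<close> is a common witness now that the boundary values agree.\<close>
  have ang: "has_angular_derivative f \<zeta> d1"
    if "((\<lambda>z. (\<eta>1 - f z) / (\<zeta> - z)) \<longlongrightarrow> d1) (at \<zeta> within \<D>)" for f
    unfolding has_angular_derivative_def has_nontangential_limit_def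
    using \<eta>T(1) by (intro bexI[of _ \<eta>1] allI impI tendsto_within_subset[OF that])
      (auto simp: nontangential_region_def)
  show ?thesis
    unfolding same_second_order_data_def same_first_order_data_def
    using rl b1 b2 ang[OF quot1(1)] ang[of \<psi>] quot2(1) by (auto simp: b d \<eta>)
qed

theorem theorem3p5:
  fixes \<phi> \<psi> :: "complex \<Rightarrow> complex" and F :: "complex set"
  assumes "analytic_self_map \<phi>" and "analytic_self_map \<psi>"
    and "unimodular_set \<phi> = F" and "unimodular_set \<psi> = F"
  shows
    "(bounded_operator_on (-1) (comp_op \<phi>) \<and> bounded_operator_on (-1) (comp_op \<psi>) \<and>
      (\<forall>\<zeta>\<in>F. second_order_data \<phi> \<zeta> \<and> second_order_data \<psi> \<zeta>) \<and>
      compact_operator_on (-1) (comp_op_diff \<phi> \<psi>)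
      \<longrightarrow> (\<forall>\<zeta>\<in>F. same_second_order_data \<phi> \<psi> \<zeta>))
     \<and>
     (\<forall>\<gamma>::real. \<gamma> > -1 \<and>
      (\<exists>\<alpha>::real. -1 \<le> \<alpha> \<and> \<alpha> < \<gamma> \<and>
         bounded_operator_on \<alpha> (comp_op \<phi>) \<and> bounded_operator_on \<alpha> (comp_op \<psi>)) \<and>
      (\<forall>\<zeta>\<in>F. finite_angular_derivative \<phi> \<zeta> \<and> finite_angular_derivative \<psi> \<zeta> \<and>
         second_order_data \<phi> \<zeta> \<and> second_order_data \<psi> \<zeta>) \<and>
      compact_operator_on \<gamma> (comp_op_diff \<phi> \<psi>)
      \<longrightarrow> (\<forall>\<zeta>\<in>F. same_second_order_data \<phi> \<psi> \<zeta>))"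
proof -
  \<comment> \<open>Part (a) is the case \<open>\<gamma> = - 1\<close> of this statement, and part
    (b) the case \<open>\<gamma> > - 1\<close>.\<close>
  have *: "same_second_order_data \<phi> \<psi> \<zeta>"
    if "\<gamma> \<ge> - 1" "compact_operator_on \<gamma> (comp_op_diff \<phi> \<psi>)" "\<zeta> \<in> F"
      "second_order_data \<phi> \<zeta>" "second_order_data \<psi> \<zeta>" for \<gamma> \<zeta>
    using compact_difference_same_second_order_data[OF that(1) assms(1,2) that(2)] that(3-) assms(3,4)
    by simp
  show ?thesis
    using *[of "- 1"] * by (meson less_imp_le order_refl)
qed

end
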